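(* Let $n\ge 2$ and let $Q_{4n}=\langle a,b\mid a^{2n}=1,\ b^2=a^n,\ b^{-1}ab=a^{-1}\rangle$ be the generalized quaternion group of order $4n$. Let $\Gamma$ be a connected $2$-distance-transitive Cayley graph over $Q_{4n}$. Then $\Gamma$ is isomorphic to one of the following graphs: (1) ${\rm K}_{x[y]}$ for some $x\ge 3$, $y\ge 2$ with $xy=4n$; (2) ${\rm K}_{2n,2n}$; (3) ${\rm K}_{2n,2n}-2n{\rm K}_2$, where $n\ge 3$; (4) $B(PG(d,q))$ or $B'(PG(d,q))$, where $2n=(q^d-1)/(q-1)$, $d\ge 2$, and $q$ is a prime power; (5) ${\rm K}_{q+1}^{2d}$, where $q$ is an odd prime power, $d\ge 2$ divides $q-1$, and $2n=d(q+1)$; (6) $X_1(4,q)$, where $q\equiv 3\pmod 4$ and $q=n-1$; (7) $\Gamma(d,q,r)$ for some integer $d\ge 2$, prime power $q$ and positive integer $r$ dividing $q-1$; (8) $X(2,2)$; (9) $X'(3,2)$; (10) $X_2(3)$.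
   Context: All graphs are finite, simple and undirected. For a group $T$ and $S\subseteq T\setminus\{1\}$ with $S=S^{-1}$, the Cayley graph $\mathrm{Cay}(T,S)$ has vertex set $T$ and edges $\{g,sg\}$ ($g\in T$, $s\in S$). A non-complete graph $\Gamma$ is $2$-distance-transitive if for $i\in\{1,2\}$ and any two ordered pairs of vertices $(u_1,v_1),(u_2,v_2)$ with $d_\Gamma(u_1,v_1)=d_\Gamma(u_2,v_2)=i$ there is an automorphism of $\Gamma$ mapping $(u_1,v_1)$ to $(u_2,v_2)$. Graphs in the list: ${\rm K}_{x[y]}$ is the complete multipartite graph with $x$ parts each of size $y$. ${\rm K}_{m,m}-m{\rm K}_2$ is the complete bipartite graph ${\rm K}_{m,m}$ with a perfect matching removed. For a $d$-dimensional vector space $V$ over $GF(q)$, $B(PG(d,q))$ here denotes the bipartite graph whose vertices are the $1$-dimensional and the $(d-1)$-dimensional subspaces of $V$, a $1$-subspace being adjacent to a $(d-1)$-subspace iff it is contained in it; $B'(PG(d,q))$ has the same vertices, a $1$-subspace and a $(d-1)$-subspace being adjacent iff they intersect in the zero subspace. Voltage graphs: for a graph $Y$ and a function $\psi$ from the arcs of $Y$ to $\mathbb{Z}_m$ with $\psi(v,u)=-\psi(u,v)$, the cover $Y\times_\psi\mathbb{Z}_m$ has vertex set $V(Y)\times\mathbb{Z}_m$, with $(u,g)\sim(v,h)$ iff $u\sim v$ in $Y$ and $h=g+\psi(u,v)$. $X_1(4,q)$ ($q\equiv3\pmod 4$ a prime power): let $Y={\rm K}_{q+1}$ with vertex set $GF(q)\cup\{\infty\}$,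 and $\psi:\mathrm{Arc}(Y)\to\mathbb{Z}_4$ given by $\psi(x,y)=0$ if $\infty\in\{x,y\}$, $\psi(x,y)=1$ if $y-x$ is a nonzero square of $GF(q)$, $\psi(x,y)=3$ if $y-x$ is a non-square; $X_1(4,q)=Y\times_\psi\mathbb{Z}_4$. ${\rm K}_{q+1}^{2d}$ ($q$ odd prime power, $d\mid q-1$, $d\ge2$): let $\theta$ generate $GF(q)^*$; take the graph ${\rm K}_{q+1,q+1}-(q+1){\rm K}_2$ with vertex set two copies $\{i\}$, $\{i'\}$ of $GF(q)\cup\{\infty\}$, where $i\sim j'$ iff $i\neq j$; define $f:\mathrm{Arc}\to\mathbb{Z}_d$ by $f(\infty',i)=f(\infty,j')=0$ for $i,j\neq\infty$, and $f(i,j')=h \bmod d$ where $j-i=\theta^h$ for $i,j\ne\infty$ (and $f$ of a reversed arc is the negative). Then ${\rm K}_{q+1}^{2d}$ is the corresponding voltage cover with group $\mathbb{Z}_d$. $\Gamma(d,q,r)$: let $V=GF(q)^d$; $\Gamma(d,q)$ is the bipartite graph whose vertices are the nonzero vectors of $V$ and the affine hyperplanes $x+H$ with $H$ a linear hyperplane and $x\in V\setminus H$, a vector being adjacent to an affine hyperplane iff it lies in it. For $r\mid q-1$ let $N$ be the subgroup of order $(q-1)/r$ of the scalar group $Z(GL(d,q))\cong\mathbb{Z}_{q-1}$, which acts naturally on these vertices; $\Gamma(d,q,r)$ is the quotient graph whose vertices are the $N$-orbits, two orbits being adjacent iff some of their elements are adjacent in $\Gamma(d,q)$. $X(2,2)$: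 let ${\rm K}_{4,4}$ have parts $\{\alpha\}$ and $\{\alpha'\}$, $\alpha\in GF(2)^2$; with $\psi(\alpha,\beta')=a_1b_1+a_2b_2\in\mathbb{Z}_2$ for $\alpha=(a_1,a_2)$, $\beta=(b_1,b_2)$, $X(2,2)={\rm K}_{4,4}\times_\psi\mathbb{Z}_2$. $X'(3,2)$: vertex set $\{i: i\in\mathbb{Z}_{14}\}\cup\{i':i\in\mathbb{Z}_{14}\}$, with $i$ adjacent to $j'$ iff $j-i\in\{0,1,9,11\}$ (mod 14), and no other edges. $X_2(3)$: let $\Delta={\rm K}_{5,5}-5{\rm K}_2$ with vertices $1,\dots,5,1',\dots,5'$ and $i\sim j'$ iff $i\ne j$. Define $\psi:\mathrm{Arc}(\Delta)\to\mathbb{Z}_3$ by $\psi_{1,j'}=0$ for all $j\ne1$, $\psi_{2,1'}=\psi_{2,3'}=\psi_{3,1'}=\psi_{3,2'}=\psi_{4,1'}=\psi_{4,5'}=\psi_{5,1'}=\psi_{5,4'}=0$, $\psi_{2,5'}=\psi_{3,4'}=\psi_{4,3'}=\psi_{5,2'}=1$, $\psi_{2,4'}=\psi_{3,5'}=\psi_{4,2'}=\psi_{5,3'}=2$; $X_2(3)=\Delta\times_\psi\mathbb{Z}_3$. *)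

theory Defs
  imports
    "Graph_Theory.Graph_Theory"
    "HOL-Algebra.Module"
    "HOL-Algebra.Multiplicative_Group"
    "HOL-Algebra.Generated_Groups"
    "HOL-Algebra.Group_Action"
    "HOL-Number_Theory.Prime_Powers"
begin

text \<open>
  A finite simple undirected graph is a symmetric loop-free \<open>pair_pre_digraph\<close>; the edge
  \<open>{u, v}\<close> is represented by the two arcs \<open>(u, v)\<close> and \<open>(v, u)\<close>. Isomorphism of graphs
  is \<open>digraph_iso\<close>, connectedness is \<open>connected\<close>.
\<close>

section \<open>Generalized quaternion groups and Cayley graphs\<close>

text \<open>
  The presentation defines a group of order \<open>4 * n\<close>. Every group generated by two elements
  satisfying the relations is a quotient of it, so requiring order \<open>4 * n\<close> leaves exactly the
  presented group, up to isomorphism.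
\<close>

definition generalized_quaternion :: "nat \<Rightarrow> ('a, 'c) monoid_scheme \<Rightarrow> bool" where
  "generalized_quaternion n Q \<longleftrightarrow> group Q \<and> order Q = 4 * n \<and>
     (\<exists>a\<in>carrier Q. \<exists>b\<in>carrier Q. generate Q {a, b} = carrier Q \<and>
        a [^]\<^bsub>Q\<^esub> (2 * n) = \<one>\<^bsub>Q\<^esub> \<and>
        b [^]\<^bsub>Q\<^esub> (2::nat) = a [^]\<^bsub>Q\<^esub> n \<and>
        inv\<^bsub>Q\<^esub> b \<otimes>\<^bsub>Q\<^esub> a \<otimes>\<^bsub>Q\<^esub> b = inv\<^bsub>Q\<^esub> a)"

definition cayley_graph :: "('a, 'c) monoid_scheme \<Rightarrow> 'a set \<Rightarrow> 'a pair_pre_digraph" where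
  "cayley_graph T S = \<lparr> pverts = carrier T, parcs = {(g, s \<otimes>\<^bsub>T\<^esub> g) | g s. g \<in> carrier T \<and> s \<in> S} \<rparr>"

section \<open>Distance and 2-distance-transitivity\<close>

definition gdist :: "'a pair_pre_digraph \<Rightarrow> 'a \<Rightarrow> 'a \<Rightarrow> ereal" where
  "gdist G = wf_digraph.\<mu> (with_proj G) (\<lambda>_. 1)"

text \<open>A function is only relevant on the vertex set, and need not be a permutation of the type.\<close>

definition graph_automorphism :: "'a pair_pre_digraph \<Rightarrow> ('a \<Rightarrow> 'a) \<Rightarrow> bool" where
  "graph_automorphism G f \<longleftrightarrow> bij_betw f (pverts G) (pverts G) \<and>
     (\<forall>u\<in>pverts G. \<forall>v\<in>pverts G. (f u, f v) \<in> parcs G \<longleftrightarrow> (u, v) \<in> parcs G)"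

definition two_distance_transitive :: "'a pair_pre_digraph \<Rightarrow> bool" where
  "two_distance_transitive G \<longleftrightarrow>
     \<not> complete_digraph (card (pverts G)) (with_proj G) \<and>
     (\<forall>i\<in>{1, 2}. \<forall>u1\<in>pverts G. \<forall>v1\<in>pverts G. \<forall>u2\<in>pverts G. \<forall>v2\<in>pverts G.
        gdist G u1 v1 = i \<and> gdist G u2 v2 = i \<longrightarrow>
        (\<exists>f. graph_automorphism G f \<and> f u1 = u2 \<and> f v1 = v2))"

section \<open>Generic constructions\<close>

text \<open>The two parts are tagged by \<open>Inl\<close> and \<open>Inr\<close>, so they are disjoint even if \<open>A\<close> and \<open>B\<close> are not.\<close>

definition bip_graph :: "'a set \<Rightarrow> 'b set \<Rightarrow> ('a \<Rightarrow> 'b \<Rightarrow> bool) \<Rightarrow> ('a + 'b) pair_pre_digraph" where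
  "bip_graph A B R = \<lparr> pverts = A <+> B,
     parcs = {(Inl x, Inr y) | x y. x \<in> A \<and> y \<in> B \<and> R x y} \<union>
             {(Inr y, Inl x) | x y. x \<in> A \<and> y \<in> B \<and> R x y} \<rparr>"

definition complete_graph_on :: "'a set \<Rightarrow> 'a pair_pre_digraph" where
  "complete_graph_on A = \<lparr> pverts = A, parcs = {(u, v). u \<in> A \<and> v \<in> A \<and> u \<noteq> v} \<rparr>"

text \<open>\<open>K\<^sub>m\<^sub>,\<^sub>m\<close> minus the perfect matching \<open>{i, i'}\<close>, on two copies of an \<open>m\<close>-element set.\<close>

definition bip_minus_matching :: "'a set \<Rightarrow> ('a + 'a) pair_pre_digraph" where
  "bip_minus_matching A = bip_graph A A (\<noteq>)"

text \<open>Part \<open>i < x\<close> of the complete multipartite graph is \<open>{i} \<times> {..<y}\<close>.\<close>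

definition complete_multipartite :: "nat \<Rightarrow> nat \<Rightarrow> (nat \<times> nat) pair_pre_digraph" where
  "complete_multipartite x y = \<lparr> pverts = {..<x} \<times> {..<y},
     parcs = {(u, v). u \<in> {..<x} \<times> {..<y} \<and> v \<in> {..<x} \<times> {..<y} \<and> fst u \<noteq> fst v} \<rparr>"

text \<open>
  \<open>\<int>\<^sub>m\<close> is represented by \<open>{0..<m}\<close>; voltages are integers read modulo \<open>m\<close>. The values of
  \<open>\<psi>\<close> outside the arcs of \<open>Y\<close> are irrelevant.
\<close>

definition voltage_cover ::
  "'a pair_pre_digraph \<Rightarrow> ('a \<Rightarrow> 'a \<Rightarrow> int) \<Rightarrow> nat \<Rightarrow> ('a \<times> int) pair_pre_digraph" where
  "voltage_cover Y \<psi> m = \<lparr> pverts = pverts Y \<times> {0..<int m},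
     parcs = {((u, g), (v, h)) | u g v h. (u, v) \<in> parcs Y \<and> g \<in> {0..<int m} \<and>
                h \<in> {0..<int m} \<and> h = (g + \<psi> u v) mod int m} \<rparr>"

text \<open>The voltage assignment on a bipartite graph with \<open>\<psi>(i, j') = f i j\<close> and \<open>\<psi>(j', i) = - f i j\<close>.\<close>

fun bip_voltage :: "('a \<Rightarrow> 'b \<Rightarrow> int) \<Rightarrow> 'a + 'b \<Rightarrow> 'a + 'b \<Rightarrow> int" where
  "bip_voltage f (Inl i) (Inr j) = f i j"
| "bip_voltage f (Inr j) (Inl i) = - f i j"
| "bip_voltage f _ _ = 0"

section \<open>Finite fields and their vector spaces\<close>

text \<open>
  A finite field of order \<open>q\<close> is unique up to isomorphism, so the graphs below are constructed
  from an arbitrary field \<open>F\<close> with \<open>is_GF q F\<close>.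
\<close>

definition is_GF :: "nat \<Rightarrow> 'a ring \<Rightarrow> bool" where
  "is_GF q F \<longleftrightarrow> field F \<and> finite (carrier F) \<and> order F = q"

text \<open>The space \<open>F\<^sup>d\<close>; the fields \<open>mult\<close> and \<open>one\<close> of the record play no role in a module.\<close>

definition vec_space :: "'a ring \<Rightarrow> nat \<Rightarrow> ('a, nat \<Rightarrow> 'a) module" where
  "vec_space F d = \<lparr> carrier = {..<d} \<rightarrow>\<^sub>E carrier F, mult = undefined, one = undefined,
     zero = (\<lambda>i\<in>{..<d}. \<zero>\<^bsub>F\<^esub>), add = (\<lambda>v w. \<lambda>i\<in>{..<d}. v i \<oplus>\<^bsub>F\<^esub> w i),
     smult = (\<lambda>c v. \<lambda>i\<in>{..<d}. c \<otimes>\<^bsub>F\<^esub> v i) \<rparr>"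

text \<open>\<open>W\<close> has a basis \<open>b 0, \<dots>, b (k - 1)\<close>: each vector of \<open>W\<close> is a unique linear combination.\<close>

definition has_dim :: "'a ring \<Rightarrow> ('a, 'v) module \<Rightarrow> 'v set \<Rightarrow> nat \<Rightarrow> bool" where
  "has_dim F V W k \<longleftrightarrow> (\<exists>b. (\<forall>j<k. b j \<in> W) \<and>
     bij_betw (\<lambda>c. \<Oplus>\<^bsub>V\<^esub>j\<in>{..<k}. c j \<odot>\<^bsub>V\<^esub> b j) ({..<k} \<rightarrow>\<^sub>E carrier F) W)"

definition subspaces_dim :: "'a ring \<Rightarrow> nat \<Rightarrow> nat \<Rightarrow> (nat \<Rightarrow> 'a) set set" where
  "subspaces_dim F d k = {W. submodule W F (vec_space F d) \<and> has_dim F (vec_space F d) W k}"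

section \<open>The graphs of the classification\<close>

definition B_PG :: "'a ring \<Rightarrow> nat \<Rightarrow> ((nat \<Rightarrow> 'a) set + (nat \<Rightarrow> 'a) set) pair_pre_digraph" where
  "B_PG F d = bip_graph (subspaces_dim F d 1) (subspaces_dim F d (d - 1)) (\<lambda>P H. P \<subseteq> H)"

definition B'_PG :: "'a ring \<Rightarrow> nat \<Rightarrow> ((nat \<Rightarrow> 'a) set + (nat \<Rightarrow> 'a) set) pair_pre_digraph" where
  "B'_PG F d = bip_graph (subspaces_dim F d 1) (subspaces_dim F d (d - 1))
     (\<lambda>P H. P \<inter> H = {\<zero>\<^bsub>vec_space F d\<^esub>})"

text \<open>\<open>GF(q) \<union> {\<infinity>}\<close>, with \<open>None\<close> as \<open>\<infinity>\<close>.\<close>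

definition proj_line :: "'a ring \<Rightarrow> 'a option set" where
  "proj_line F = insert None (Some ` carrier F)"

definition psi_X1 :: "'a ring \<Rightarrow> 'a option \<Rightarrow> 'a option \<Rightarrow> int" where
  "psi_X1 F u v = (case (u, v) of
       (Some x, Some y) \<Rightarrow>
         if \<exists>z\<in>carrier F - {\<zero>\<^bsub>F\<^esub>}. y \<ominus>\<^bsub>F\<^esub> x = z [^]\<^bsub>F\<^esub> (2::nat) then 1 else 3
     | _ \<Rightarrow> 0)"

definition X1 :: "'a ring \<Rightarrow> ('a option \<times> int) pair_pre_digraph" where
  "X1 F = voltage_cover (complete_graph_on (proj_line F)) (psi_X1 F) 4"

text \<open>
  If \<open>\<theta>\<close> generates the multiplicative group, the exponent \<open>h\<close> is determined modulo \<open>q - 1\<close>, hence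
  modulo every divisor \<open>d\<close> of \<open>q - 1\<close>.
\<close>

definition volt_K2d :: "'a ring \<Rightarrow> 'a \<Rightarrow> nat \<Rightarrow> 'a option \<Rightarrow> 'a option \<Rightarrow> int" where
  "volt_K2d F \<theta> d u v = (case (u, v) of
       (Some i, Some j) \<Rightarrow> int ((LEAST h::nat. j \<ominus>\<^bsub>F\<^esub> i = \<theta> [^]\<^bsub>F\<^esub> h) mod d)
     | _ \<Rightarrow> 0)"

definition K2d :: "'a ring \<Rightarrow> 'a \<Rightarrow> nat \<Rightarrow> (('a option + 'a option) \<times> int) pair_pre_digraph" where
  "K2d F \<theta> d = voltage_cover (bip_minus_matching (proj_line F)) (bip_voltage (volt_K2d F \<theta> d)) d"

text \<open>\<open>\<Gamma>(d, q)\<close>: nonzero vectors against affine hyperplanes not containing the origin.\<close>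

definition affine_hyperplanes :: "'a ring \<Rightarrow> nat \<Rightarrow> (nat \<Rightarrow> 'a) set set" where
  "affine_hyperplanes F d = {x <+\<^bsub>vec_space F d\<^esub> H | x H.
     H \<in> subspaces_dim F d (d - 1) \<and> x \<in> carrier (vec_space F d) - H}"

definition Gamma_dq :: "'a ring \<Rightarrow> nat \<Rightarrow> ((nat \<Rightarrow> 'a) + (nat \<Rightarrow> 'a) set) pair_pre_digraph" where
  "Gamma_dq F d = bip_graph (carrier (vec_space F d) - {\<zero>\<^bsub>vec_space F d\<^esub>})
     (affine_hyperplanes F d) (\<in>)"

definition scalar_act ::
  "'a ring \<Rightarrow> nat \<Rightarrow> 'a \<Rightarrow> (nat \<Rightarrow> 'a) + (nat \<Rightarrow> 'a) set \<Rightarrow> (nat \<Rightarrow> 'a) + (nat \<Rightarrow> 'a) set" where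
  "scalar_act F d c =
     map_sum (\<lambda>v. c \<odot>\<^bsub>vec_space F d\<^esub> v) (image (\<lambda>v. c \<odot>\<^bsub>vec_space F d\<^esub> v))"

definition orbit_quotient ::
  "('g, 'c) monoid_scheme \<Rightarrow> ('g \<Rightarrow> 'a \<Rightarrow> 'a) \<Rightarrow> 'a pair_pre_digraph \<Rightarrow> 'a set pair_pre_digraph" where
  "orbit_quotient G \<phi> Y = \<lparr> pverts = Group_Action.orbits G (pverts Y) \<phi>,
     parcs = {(A, B). A \<in> Group_Action.orbits G (pverts Y) \<phi> \<and> B \<in> Group_Action.orbits G (pverts Y) \<phi> \<and>
                (\<exists>x\<in>A. \<exists>y\<in>B. (x, y) \<in> parcs Y)} \<rparr>"

text \<open>
  The scalar group \<open>Z(GL(d, q))\<close> is identified with \<open>mult_of F\<close>. The cyclic group \<open>mult_of F\<close> has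
  exactly one subgroup \<open>N\<close> of order \<open>(q - 1) / r\<close>.
\<close>

definition scalar_subgroup :: "'a ring \<Rightarrow> nat \<Rightarrow> 'a set \<Rightarrow> bool" where
  "scalar_subgroup F r N \<longleftrightarrow> subgroup N (mult_of F) \<and> card N = (order F - 1) div r"

definition Gamma_dqN ::
  "'a ring \<Rightarrow> nat \<Rightarrow> 'a set \<Rightarrow> ((nat \<Rightarrow> 'a) + (nat \<Rightarrow> 'a) set) set pair_pre_digraph" where
  "Gamma_dqN F d N = orbit_quotient ((mult_of F)\<lparr>carrier := N\<rparr>) (scalar_act F d) (Gamma_dq F d)"

text \<open>\<open>GF(2)\<close> is represented by \<open>{0, 1}\<close> here, the voltage being read modulo 2.\<close>

definition X_2_2 :: "((int \<times> int + int \<times> int) \<times> int) pair_pre_digraph" where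
  "X_2_2 = voltage_cover
     (bip_graph ({0, 1} \<times> {0, 1}) ({0, 1} \<times> {0, 1}) (\<lambda>_ _. True))
     (bip_voltage (\<lambda>(a1, a2) (b1, b2). a1 * b1 + a2 * b2)) 2"

definition X'_3_2 :: "(int + int) pair_pre_digraph" where
  "X'_3_2 = bip_graph {0..<14} {0..<14} (\<lambda>i j. (j - i) mod 14 \<in> {0, 1, 9, 11})"

definition psi_X2_3 :: "nat \<Rightarrow> nat \<Rightarrow> int" where
  "psi_X2_3 i j =
     (if (i, j) \<in> {(2, 5), (3, 4), (4, 3), (5, 2)} then 1
      else if (i, j) \<in> {(2, 4), (3, 5), (4, 2), (5, 3)} then 2
      else 0)"

definition X2_3 :: "((nat + nat) \<times> int) pair_pre_digraph" where
  "X2_3 = voltage_cover (bip_minus_matching {1..5}) (bip_voltage psi_X2_3) 3"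

section \<open>Well-formedness of the constructions\<close>

lemma pair_graph_bip: "finite A \<Longrightarrow> finite B \<Longrightarrow> pair_graph (bip_graph A B R)"
proof -
  assume f: "finite A" "finite B"
  have s: "parcs (bip_graph A B R) \<subseteq> (A <+> B) \<times> (A <+> B)" by (auto simp: bip_graph_def)
  have "finite (parcs (bip_graph A B R))" using f by (intro finite_subset[OF s]) auto
  then show ?thesis using f s
  by unfold_locales (auto simp: bip_graph_def symmetric_def sym_def)
qed

lemma pair_graph_cayley:
  assumes "group T" "finite (carrier T)" "S \<subseteq> carrier T - {\<one>\<^bsub>T\<^esub>}" "S = m_inv T ` S"
  shows "pair_graph (cayley_graph T S)"
proof -
  interpret group T by fact
  have s: "parcs (cayley_graph T S) \<subseteq> carrier T \<times> carrier T" using assms(3) by (auto simp: cayley_graph_def)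
  have f: "finite (parcs (cayley_graph T S))" using assms by (intro finite_subset[OF s]) auto
  have sy: "sym (parcs (cayley_graph T S))"
  proof (rule symI)
    fix u v assume "(u, v) \<in> parcs (cayley_graph T S)"
    then obtain t where t: "t \<in> S" "v = t \<otimes>\<^bsub>T\<^esub> u" "u \<in> carrier T" by (auto simp: cayley_graph_def)
    have tc: "t \<in> carrier T" and ti: "inv\<^bsub>T\<^esub> t \<in> S" using assms(3,4) t by auto
    have "u = inv\<^bsub>T\<^esub> t \<otimes>\<^bsub>T\<^esub> v" using t tc by (simp add: m_assoc[symmetric])
    moreover have "v \<in> carrier T" using t tc by auto
    ultimately show "(v, u) \<in> parcs (cayley_graph T S)" using ti by (auto simp: cayley_graph_def)
  qed
  show ?thesis
    using f sy s assms
    by unfold_locales (auto simp: cayley_graph_def symmetric_def)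
qed

lemma pair_graph_cover:
  assumes "pair_graph Y" "m > 0" and ac: "\<And>u v. (u,v) \<in> parcs Y \<Longrightarrow> (\<psi> v u + \<psi> u v) mod int m = 0"
  shows "pair_graph (voltage_cover Y \<psi> m)"
proof -
  interpret Y: pair_graph Y by fact
  have s: "parcs (voltage_cover Y \<psi> m) \<subseteq> (pverts Y \<times> {0..<int m}) \<times> (pverts Y \<times> {0..<int m})"
    using Y.wellformed' by (auto simp: voltage_cover_def)
  have f: "finite (parcs (voltage_cover Y \<psi> m))"
    using Y.pair_finite_verts by (intro finite_subset[OF s]) auto
  have sy: "sym (parcs (voltage_cover Y \<psi> m))"
  proof (rule symI)
    fix a b assume "(a, b) \<in> parcs (voltage_cover Y \<psi> m)"
    then obtain u g v h where *: "a = (u,g)" "b = (v,h)" "(u,v) \<in> parcs Y" "g \<in> {0..<int m}"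
       "h \<in> {0..<int m}" "h = (g + \<psi> u v) mod int m" by (auto simp: voltage_cover_def)
    have "(v,u) \<in> parcs Y" using Y.pair_sym_arcs *(3) by (auto simp: symmetric_def sym_def)
    moreover have "(h + \<psi> v u) mod int m = (g + (\<psi> v u + \<psi> u v)) mod int m"
      unfolding *(6) by (simp add: mod_simps algebra_simps)
    then have "(h + \<psi> v u) mod int m = (g + (\<psi> v u + \<psi> u v) mod int m) mod int m"
      by (simp add: mod_simps)
    then have "g = (h + \<psi> v u) mod int m" using ac[OF *(3)] *(4) by simp
    ultimately show "(b, a) \<in> parcs (voltage_cover Y \<psi> m)" using * unfolding voltage_cover_def by auto
  qed
  show ?thesis
    using f sy s Y.pair_finite_verts Y.pair_no_loops Y.wellformed'
    by unfold_locales (auto simp: voltage_cover_def symmetric_def)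
qed

lemma module_vec_space: assumes "field F" shows "module F (vec_space F d)"
proof -
  interpret field F by fact
  show ?thesis
  proof (rule moduleI)
    show "cring F" ..
    show "abelian_group (vec_space F d)"
    proof (rule abelian_groupI)
      fix x assume x: "x \<in> carrier (vec_space F d)"
      then have "(\<lambda>i\<in>{..<d}. \<ominus>\<^bsub>F\<^esub> x i) \<oplus>\<^bsub>vec_space F d\<^esub> x = \<zero>\<^bsub>vec_space F d\<^esub>"
       "(\<lambda>i\<in>{..<d}. \<ominus>\<^bsub>F\<^esub> x i) \<in> carrier (vec_space F d)"
        by (auto simp: vec_space_def PiE_iff fun_eq_iff l_neg restrict_def extensional_def)
      then show "\<exists>y\<in>carrier (vec_space F d). y \<oplus>\<^bsub>vec_space F d\<^esub> x = \<zero>\<^bsub>vec_space F d\<^esub>" by blast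
    qed (auto simp: vec_space_def PiE_iff fun_eq_iff a_ac extensional_def)
  qed (auto simp: vec_space_def PiE_iff fun_eq_iff l_distr r_distr m_assoc extensional_def)
qed

end

theory Submission
  imports Defs
begin

text \<open>
  Only the first two families occur, and the reason is a parity argument. Let \<open>A\<close> be the cyclic
  subgroup generated by \<open>a\<close>, let \<open>z = a\<^sup>n\<close> be the central involution, and let \<open>f y\<close> be the number of
  common neighbours of \<open>1\<close> and \<open>y\<close>. Then \<open>f\<close> is constant on \<open>S\<close> and constant on the vertices at
  distance 2 from \<open>1\<close>. Elements outside \<open>A\<close> satisfy \<open>s\<^sup>-\<^sup>1 = z s\<close>, so \<open>S - A\<close> is invariant under \<open>z\<close>;
  also \<open>f y\<close> is even for \<open>y\<close> outside \<open>A\<close>, while for \<open>i\<close> in \<open>S \<inter> A\<close> with \<open>i\<^sup>2 \<noteq> 1\<close> the number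
  \<open>f (i\<^sup>2)\<close> is even only if \<open>z i\<close> lies in \<open>S\<close>.

  If \<open>f\<close> is even at distance 2, then \<open>S - {z}\<close> is invariant under \<open>z\<close>. Either \<open>z\<close> is not in \<open>S\<close>
  and \<open>z\<close> is a twin of \<open>1\<close>, so that any two vertices at distance 2 are twins, or the ends of every
  edge have the same closed neighbourhood. If \<open>f\<close> is odd at distance 2, then all of \<open>Q - A\<close> lies in
  \<open>S\<close>, so every vertex is adjacent to an end of the edge \<open>{1, s}\<close> for \<open>s\<close> outside \<open>A\<close> and hence, by
  arc-transitivity, to an end of any given edge; again vertices at distance 2 are twins. In a
  connected graph with this property non-adjacency is an equivalence relation.
\<close>

section \<open>Parity by involutions\<close>

text \<open>Every orbit \<open>{x, f x}\<close> has exactly two elements, so removing one orbit at a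
  time preserves the parity of the cardinality.\<close>

lemma even_card_fixpoint_free_involution:
  assumes "finite X" "\<And>x. x \<in> X \<Longrightarrow> f x \<in> X" "\<And>x. x \<in> X \<Longrightarrow> f (f x) = x" "\<And>x. x \<in> X \<Longrightarrow> f x \<noteq> x"
  shows "even (card X)"
  using assms
proof (induction X rule: finite_psubset_induct)
  case (psubset X)
  show ?case
  proof (cases "X = {}")
    case False
    then obtain x where x: "x \<in> X" by blast
    let ?Y = "X - {x, f x}"
    have "even (card ?Y)"
    proof (rule psubset.IH)
      show "?Y \<subset> X" using x by blast
      fix y assume y: "y \<in> ?Y"
      have "f y \<noteq> x" "f y \<noteq> f x" using y x psubset.prems(2) by (metis Diff_iff insertCI)+
      then show "f y \<in> ?Y" "f (f y) = y" "f y \<noteq> y" using y psubset.prems by auto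
    qed
    moreover have "card X = card ?Y + 2"
    proof -
      have "{x, f x} \<subseteq> X" "card {x, f x} = 2" using x psubset.prems by (auto simp: eq_commute)
      then show ?thesis using psubset.hyps(1) card_mono[of X "{x, f x}"] by (simp add: card_Diff_subset)
    qed
    ultimately show ?thesis by simp
  qed simp
qed

section \<open>Structure of the generalized quaternion group\<close>

text \<open>A description without generators, in the form used by the parity arguments.
  \<open>index_two\<close> makes the index of \<open>A\<close> at most 2. Cyclicity of
  \<open>A\<close> survives as commutativity and as \<open>square_eq\<close>: two square roots in
  \<open>A\<close> of the same element differ at most by the factor \<open>z\<close>.\<close>

locale quaternion_group = group Q for Q (structure) +
  fixes A :: "'a set" and z :: 'a
  assumes finite_carrier: "finite (carrier Q)"
    and subgroup_A: "subgroup A Q"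
    and comm_A: "\<lbrakk>x \<in> A; y \<in> A\<rbrakk> \<Longrightarrow> x \<otimes> y = y \<otimes> x"
    and index_two: "\<lbrakk>x \<in> carrier Q - A; y \<in> carrier Q - A\<rbrakk> \<Longrightarrow> x \<otimes> y \<in> A"
    and z_in_A: "z \<in> A" and z_neq_one: "z \<noteq> \<one>"
    and square_outside: "x \<in> carrier Q - A \<Longrightarrow> x \<otimes> x = z"
    and inverts: "\<lbrakk>x \<in> carrier Q - A; y \<in> A\<rbrakk> \<Longrightarrow> x \<otimes> y = inv y \<otimes> x"
    and square_eq: "\<lbrakk>x \<in> A; y \<in> A; x \<otimes> x = y \<otimes> y\<rbrakk> \<Longrightarrow> y = x \<or> y = z \<otimes> x"
    and z_square: "z \<otimes> z = \<one>"

lemma generalized_quaternion_cyclic_subgroup: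
  assumes "n \<ge> 2" "generalized_quaternion n Q"
  obtains A z where "quaternion_group Q A z" "card A = 2 * n"
proof -
  from assms(2) interpret group Q by (simp add: generalized_quaternion_def)
  from assms(2) obtain a b where a: "a \<in> carrier Q" and b: "b \<in> carrier Q"
    and gen: "generate Q {a, b} = carrier Q" and rel: "a [^]\<^bsub>Q\<^esub> (2 * n) = \<one>\<^bsub>Q\<^esub>"
      "b [^]\<^bsub>Q\<^esub> (2::nat) = a [^]\<^bsub>Q\<^esub> n" "inv\<^bsub>Q\<^esub> b \<otimes>\<^bsub>Q\<^esub> a \<otimes>\<^bsub>Q\<^esub> b = inv\<^bsub>Q\<^esub> a"
    and ord: "order Q = 4 * n"
    by (auto simp: generalized_quaternion_def)
  have fin: "finite (carrier Q)" using ord assms(1) by (simp add: order_def card_ge_0_finite)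
  define A where "A = generate Q {a}"
  define z where "z = a [^]\<^bsub>Q\<^esub> n"
  have A_int: "A = {a [^]\<^bsub>Q\<^esub> k | k::int. True}" unfolding A_def using generate_pow[OF a] by auto
  have subA: "subgroup A Q" unfolding A_def using a by (simp add: generate_is_subgroup)
  interpret A: subgroup A Q by (fact subA)
  have commA: "x \<otimes>\<^bsub>Q\<^esub> y = y \<otimes>\<^bsub>Q\<^esub> x" if "x \<in> A" "y \<in> A" for x y
    using that a by (auto simp: A_int simp flip: int_pow_mult) (simp add: add.commute)
  have aA: "a \<in> A" unfolding A_def by (simp add: generate.incl)
  have zA: "z \<in> A" unfolding A_int z_def by (metis (mono_tags, lifting) int_pow_int mem_Collect_eq)
  have bb: "b \<otimes>\<^bsub>Q\<^esub> b = z" using rel(2) b by (simp add: z_def numeral_2_eq_2)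
  \<comment> \<open>On the abelian group \<open>A\<close> both conjugation by \<open>b\<close> and
    inversion are homomorphisms, and by the relation they agree on the generator
    \<open>a\<close>.\<close>
  have conj_int: "inv\<^bsub>Q\<^esub> b \<otimes>\<^bsub>Q\<^esub> x \<otimes>\<^bsub>Q\<^esub> b = inv\<^bsub>Q\<^esub> x" if "x \<in> A" for x
    using that unfolding A_def
  proof (induction rule: generate.induct)
    case one then show ?case using b by simp
  next
    case (incl h) then show ?case using rel by simp
  next
    case (inv h)
    then have "inv\<^bsub>Q\<^esub> (inv\<^bsub>Q\<^esub> b \<otimes>\<^bsub>Q\<^esub> a \<otimes>\<^bsub>Q\<^esub> b) = inv\<^bsub>Q\<^esub> (inv\<^bsub>Q\<^esub> a)" by (simp add: rel)
    then show ?case using inv a b by (simp add: inv_mult_group m_assoc)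
  next
    case (eng x y)
    have xy: "x \<in> A" "y \<in> A" using eng by (auto simp: A_def)
    then have c: "x \<in> carrier Q" "y \<in> carrier Q" by auto
    have "inv\<^bsub>Q\<^esub> b \<otimes>\<^bsub>Q\<^esub> (x \<otimes>\<^bsub>Q\<^esub> y) \<otimes>\<^bsub>Q\<^esub> b = (inv\<^bsub>Q\<^esub> b \<otimes>\<^bsub>Q\<^esub> x \<otimes>\<^bsub>Q\<^esub> b) \<otimes>\<^bsub>Q\<^esub> (inv\<^bsub>Q\<^esub> b \<otimes>\<^bsub>Q\<^esub> y \<otimes>\<^bsub>Q\<^esub> b)"
      using b c by (simp add: m_assoc) (metis inv_closed l_one m_assoc m_closed r_inv)
    also have "\<dots> = inv\<^bsub>Q\<^esub> (x \<otimes>\<^bsub>Q\<^esub> y)" using eng c commA xy by (simp add: inv_mult_group)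
    finally show ?case .
  qed
  have xb: "x \<otimes>\<^bsub>Q\<^esub> b = b \<otimes>\<^bsub>Q\<^esub> inv\<^bsub>Q\<^esub> x" if "x \<in> A" for x
    using conj_int[OF that] that b by (metis A.mem_carrier inv_closed inv_solve_left m_assoc m_closed)
  have bx: "b \<otimes>\<^bsub>Q\<^esub> x = inv\<^bsub>Q\<^esub> x \<otimes>\<^bsub>Q\<^esub> b" if "x \<in> A" for x
    using xb[of "inv\<^bsub>Q\<^esub> x"] that by simp
  have ib: "inv\<^bsub>Q\<^esub> b = inv\<^bsub>Q\<^esub> z \<otimes>\<^bsub>Q\<^esub> b"
    using bb b zA by (metis A.mem_carrier inv_equality inv_solve_left inv_closed l_inv m_assoc m_closed r_inv bx)
  have m1: "u \<otimes>\<^bsub>Q\<^esub> (v \<otimes>\<^bsub>Q\<^esub> b) = (u \<otimes>\<^bsub>Q\<^esub> v) \<otimes>\<^bsub>Q\<^esub> b" if "u \<in> A" "v \<in> A" for u v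
    using that b by (simp add: m_assoc)
  have m2: "(u \<otimes>\<^bsub>Q\<^esub> b) \<otimes>\<^bsub>Q\<^esub> v = (u \<otimes>\<^bsub>Q\<^esub> inv\<^bsub>Q\<^esub> v) \<otimes>\<^bsub>Q\<^esub> b" if "u \<in> A" "v \<in> A" for u v
    using that b bx by (simp add: m_assoc)
  have m3: "(u \<otimes>\<^bsub>Q\<^esub> b) \<otimes>\<^bsub>Q\<^esub> (v \<otimes>\<^bsub>Q\<^esub> b) = u \<otimes>\<^bsub>Q\<^esub> inv\<^bsub>Q\<^esub> v \<otimes>\<^bsub>Q\<^esub> z" if "u \<in> A" "v \<in> A" for u v
  proof -
    have "(u \<otimes>\<^bsub>Q\<^esub> b) \<otimes>\<^bsub>Q\<^esub> (v \<otimes>\<^bsub>Q\<^esub> b) = ((u \<otimes>\<^bsub>Q\<^esub> b) \<otimes>\<^bsub>Q\<^esub> v) \<otimes>\<^bsub>Q\<^esub> b"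
      using that b by (simp add: m_assoc)
    also have "\<dots> = u \<otimes>\<^bsub>Q\<^esub> inv\<^bsub>Q\<^esub> v \<otimes>\<^bsub>Q\<^esub> (b \<otimes>\<^bsub>Q\<^esub> b)"
      unfolding m2[OF that] using that b by (simp add: m_assoc)
    finally show ?thesis by (simp add: bb)
  qed
  \<comment> \<open>By \<open>m1\<close>, \<open>m2\<close> and \<open>m3\<close> the union of
    \<open>A\<close> and the coset of \<open>b\<close> is closed under products, and it contains the
    generators and their inverses.\<close>
  have cover: "x \<in> A \<or> (\<exists>y\<in>A. x = y \<otimes>\<^bsub>Q\<^esub> b)" if "x \<in> carrier Q" for x
    using that unfolding gen[symmetric]
  proof (induction rule: generate.induct)
    case one then show ?case by simp
  next
    case (incl h) then show ?case using aA b A.one_closed by (auto intro: bexI[of _ "\<one>\<^bsub>Q\<^esub>"])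
  next
    case (inv h) then show ?case using aA ib zA by auto
  next
    case (eng x y)
    from eng.IH consider "x \<in> A" "y \<in> A" | v where "x \<in> A" "v \<in> A" "y = v \<otimes>\<^bsub>Q\<^esub> b"
      | u where "u \<in> A" "x = u \<otimes>\<^bsub>Q\<^esub> b" "y \<in> A"
      | u v where "u \<in> A" "x = u \<otimes>\<^bsub>Q\<^esub> b" "v \<in> A" "y = v \<otimes>\<^bsub>Q\<^esub> b" by blast
    then show ?case
    proof cases
      case 1 then show ?thesis by simp
    next
      case 2 then show ?thesis using m1 by auto
    next
      case 3 then show ?thesis using m2 by auto
    next
      case 4 then show ?thesis using m3 zA by simp
    qed
  qed
  have cardA: "card A \<le> 2 * n"
    using generate_pow_card[OF a] rel(1) pow_eq_id[OF a] assms(1) by (auto simp: A_def intro: dvd_imp_le)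
  have cardAb: "card (A #>\<^bsub>Q\<^esub> b) = card A"
    using card_rcosets_equal[OF rcosetsI[OF A.subset b] A.subset] by simp
  have UN: "carrier Q = A \<union> (A #>\<^bsub>Q\<^esub> b)"
    using cover b by (auto simp: r_coset_def)
  have finA: "finite A" "finite (A #>\<^bsub>Q\<^esub> b)" using fin UN by (metis finite_Un)+
  \<comment> \<open>Two sets of equal size, each with at most \<open>2 * n\<close> elements, cover a
    group of order \<open>4 * n\<close>. Hence both have exactly \<open>2 * n\<close> elements and
    they are disjoint.\<close>
  have "card A + card (A #>\<^bsub>Q\<^esub> b) = card (carrier Q) + card (A \<inter> (A #>\<^bsub>Q\<^esub> b))"
    unfolding UN using card_Un_Int[OF finA] by simp
  then have cA: "card A = 2 * n" and "card (A \<inter> (A #>\<^bsub>Q\<^esub> b)) = 0"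
    using ord cardA cardAb by (auto simp: order_def)
  then have disj: "A \<inter> (A #>\<^bsub>Q\<^esub> b) = {}" using finA by simp
  have orda: "ord a = 2 * n" using cA generate_pow_card[OF a] by (simp add: A_def)
  have out: "\<exists>y\<in>A. x = y \<otimes>\<^bsub>Q\<^esub> b" if "x \<in> carrier Q - A" for x using cover that by blast
  have zz: "z \<otimes>\<^bsub>Q\<^esub> z = \<one>\<^bsub>Q\<^esub>" using rel(1) a by (simp add: z_def nat_pow_mult flip: mult_2)
  have "quaternion_group Q A z"
  proof unfold_locales
    show "finite (carrier Q)" "z \<in> A" "z \<otimes>\<^bsub>Q\<^esub> z = \<one>\<^bsub>Q\<^esub>" by fact+
    show "z \<noteq> \<one>\<^bsub>Q\<^esub>" using pow_eq_id[OF a, of n] orda assms(1) by (auto simp: z_def dest: dvd_imp_le)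
  next
    fix x y assume "x \<in> A" "y \<in> A" then show "x \<otimes>\<^bsub>Q\<^esub> y = y \<otimes>\<^bsub>Q\<^esub> x" by (rule commA)
  next
    fix x y assume "x \<in> carrier Q - A" "y \<in> carrier Q - A"
    then obtain u v where "u \<in> A" "v \<in> A" "x = u \<otimes>\<^bsub>Q\<^esub> b" "y = v \<otimes>\<^bsub>Q\<^esub> b" using out by metis
    then show "x \<otimes>\<^bsub>Q\<^esub> y \<in> A" using m3 zA by simp
  next
    fix x assume "x \<in> carrier Q - A"
    then obtain u where u: "u \<in> A" "x = u \<otimes>\<^bsub>Q\<^esub> b" using out by metis
    then show "x \<otimes>\<^bsub>Q\<^esub> x = z" using m3 zA by simp
  next
    fix x y assume "x \<in> carrier Q - A" and y: "y \<in> A"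
    then obtain u where u: "u \<in> A" "x = u \<otimes>\<^bsub>Q\<^esub> b" using out by metis
    then show "x \<otimes>\<^bsub>Q\<^esub> y = inv\<^bsub>Q\<^esub> y \<otimes>\<^bsub>Q\<^esub> x"
      using m1 m2 commA y by simp
  next
    fix x y assume xy: "x \<in> A" "y \<in> A" "x \<otimes>\<^bsub>Q\<^esub> x = y \<otimes>\<^bsub>Q\<^esub> y"
    \<comment> \<open>The quotient \<open>w\<close> of the two roots squares to the identity. As
      \<open>a\<close> has order \<open>2 * n\<close>, the exponent of \<open>w\<close> is a
      multiple of \<open>n\<close>, so \<open>w\<close> is a power of the involution
      \<open>z\<close>.\<close>
    define w where "w = y \<otimes>\<^bsub>Q\<^esub> inv\<^bsub>Q\<^esub> x"
    have wA: "w \<in> A" using xy by (simp add: w_def)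
    then obtain k :: int where k: "w = a [^]\<^bsub>Q\<^esub> k" by (auto simp: A_int)
    have "w \<otimes>\<^bsub>Q\<^esub> w = y \<otimes>\<^bsub>Q\<^esub> (inv\<^bsub>Q\<^esub> x \<otimes>\<^bsub>Q\<^esub> y) \<otimes>\<^bsub>Q\<^esub> inv\<^bsub>Q\<^esub> x"
      using xy by (simp add: w_def m_assoc)
    also have "\<dots> = (y \<otimes>\<^bsub>Q\<^esub> y) \<otimes>\<^bsub>Q\<^esub> inv\<^bsub>Q\<^esub> (x \<otimes>\<^bsub>Q\<^esub> x)"
      using xy(1,2) commA[of "inv\<^bsub>Q\<^esub> x" y] by (simp add: inv_mult_group m_assoc)
    finally have "w \<otimes>\<^bsub>Q\<^esub> w = (y \<otimes>\<^bsub>Q\<^esub> y) \<otimes>\<^bsub>Q\<^esub> inv\<^bsub>Q\<^esub> (x \<otimes>\<^bsub>Q\<^esub> x)" .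
    then have "w \<otimes>\<^bsub>Q\<^esub> w = \<one>\<^bsub>Q\<^esub>" using xy by simp
    then have "a [^]\<^bsub>Q\<^esub> (2 * k) = \<one>\<^bsub>Q\<^esub>" unfolding mult_2 int_pow_mult[OF a] k .
    then have "int n dvd k" using int_pow_eq_id[OF a] orda by simp
    then obtain m where m: "k = int n * m" by blast
    have w: "w = z [^]\<^bsub>Q\<^esub> m" unfolding k m z_def using a by (simp add: int_pow_pow flip: int_pow_int)
    have zc: "z \<in> carrier Q" using zA by simp
    have z2: "z [^]\<^bsub>Q\<^esub> (2 * l) = \<one>\<^bsub>Q\<^esub>" for l :: int
    proof -
      have "z [^]\<^bsub>Q\<^esub> (2::int) = \<one>\<^bsub>Q\<^esub>" using zz zc int_pow_mult[of z 1 1] by (simp add: int_pow_1)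
      then show ?thesis using zc by (metis int_pow_pow int_pow_one)
    qed
    have "w = \<one>\<^bsub>Q\<^esub> \<or> w = z"
    proof (cases "even m")
      case True then show ?thesis using w z2 by auto
    next
      case False
      then obtain l where "m = 2 * l + 1" by (elim oddE)
      then show ?thesis using w z2 zc by (simp add: int_pow_mult int_pow_1)
    qed
    moreover have "y = w \<otimes>\<^bsub>Q\<^esub> x" using xy by (simp add: w_def m_assoc)
    ultimately show "y = x \<or> y = z \<otimes>\<^bsub>Q\<^esub> x" using xy by auto
  qed
  with cA show thesis using that by blast
qed

context quaternion_group begin

sublocale A: subgroup A Q by (fact subgroup_A)

lemma z_closed [simp]: "z \<in> carrier Q" using z_in_A by simp

lemma inv_z [simp]: "inv z = z" using z_square by (simp add: inv_equality)

lemma z_cancel [simp]: "x \<in> carrier Q \<Longrightarrow> z \<otimes> (z \<otimes> x) = x"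
  by (metis l_one m_assoc z_closed z_square)

lemma z_central: "x \<in> carrier Q \<Longrightarrow> x \<otimes> z = z \<otimes> x"
  using inverts[of x z] comm_A[of x z] z_in_A by (cases "x \<in> A") auto

lemma inv_outside: "x \<in> carrier Q - A \<Longrightarrow> inv x = z \<otimes> x"
  using square_outside[of x] z_square by (intro inv_equality) (auto simp: m_assoc)

lemma mult_outside:
  assumes "x \<in> A" "y \<in> carrier Q - A"
  shows "x \<otimes> y \<in> carrier Q - A" "y \<otimes> x \<in> carrier Q - A"
proof -
  have "x \<otimes> y \<notin> A"
  proof
    assume "x \<otimes> y \<in> A"
    then have "inv x \<otimes> (x \<otimes> y) \<in> A" using assms(1) by simp
    then show False using assms by (simp add: m_assoc[symmetric])
  qed
  then show 1: "x \<otimes> y \<in> carrier Q - A" using assms by auto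
  have "y \<otimes> x \<notin> A"
  proof
    assume "y \<otimes> x \<in> A"
    then have "(y \<otimes> x) \<otimes> inv x \<in> A" using assms(1) by simp
    then show False using assms by (simp add: m_assoc)
  qed
  then show "y \<otimes> x \<in> carrier Q - A" using assms by auto
qed

lemma inv_outside_A: "x \<in> carrier Q - A \<Longrightarrow> inv x \<in> carrier Q - A"
  using A.m_inv_closed[of "inv x"] by auto

end

section \<open>Parity of the number of common neighbours\<close>

locale quaternion_cayley = quaternion_group +
  fixes S :: "'a set"
  assumes S_subset: "S \<subseteq> carrier Q - {\<one>}"
    and S_inv: "s \<in> S \<Longrightarrow> inv s \<in> S"
begin

text \<open>The common neighbours of \<open>\<one>\<close> and \<open>y\<close> in the Cayley graph,
  for \<open>y\<close> in the group: \<open>v\<close> is adjacent to \<open>y\<close> exactly if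
  \<open>v \<otimes> inv y\<close> lies in \<open>S\<close>.\<close>

definition common :: "'a \<Rightarrow> 'a set" where
  "common y = {v \<in> S. v \<otimes> inv y \<in> S}"

text \<open>The vertices at distance 2 from \<open>\<one>\<close>, described without walks so that
  the counting stays inside the group.\<close>

definition at_two :: "'a set" where
  "at_two = {y \<in> carrier Q. y \<noteq> \<one> \<and> y \<notin> S \<and> common y \<noteq> {}}"

lemma S_closed [simp]: "s \<in> S \<Longrightarrow> s \<in> carrier Q" using S_subset by auto

lemma one_notin_S [simp]: "\<one> \<notin> S" using S_subset by auto

lemma S_inv_iff: "x \<in> carrier Q \<Longrightarrow> inv x \<in> S \<longleftrightarrow> x \<in> S"
  using S_inv S_inv[of "inv x"] by auto

lemma S_inv_mult: "\<lbrakk>x \<in> carrier Q; y \<in> carrier Q\<rbrakk> \<Longrightarrow> x \<otimes> inv y \<in> S \<longleftrightarrow> y \<otimes> inv x \<in> S"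
  using S_inv_iff[of "x \<otimes> inv y"] by (simp add: inv_mult_group)

lemma finite_S: "finite S" using finite_carrier S_subset finite_subset by blast

lemma finite_common: "finite (common y)" using finite_S by (simp add: common_def)

lemma z_mult_S: "\<lbrakk>s \<in> S; s \<notin> A\<rbrakk> \<Longrightarrow> z \<otimes> s \<in> S"
  using inv_outside[of s] S_inv[of s] by simp

lemma common_mult:
  assumes "s \<in> S" "t \<in> S" shows "t \<in> common (s \<otimes> t)"
  using assms S_inv[of s] by (simp add: common_def inv_mult_group m_assoc[symmetric])

lemma common_full: "y \<in> carrier Q \<Longrightarrow> card (common y) = card S \<Longrightarrow> common y = S"
  using finite_S by (intro card_subset_eq) (auto simp: common_def)

text \<open>For \<open>y\<close> outside \<open>A\<close>, the factorizations \<open>y = p q = q p\<^sup>-\<^sup>1\<close> with \<open>p\<close> in \<open>A\<close> come in pairs.\<close>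

lemma even_common_outside:
  assumes "y \<in> carrier Q - A"
  shows "even (card (common y))"
proof (rule even_card_fixpoint_free_involution[where f = "\<lambda>v. if v \<in> A then v \<otimes> y else v \<otimes> inv y"])
  have y: "y \<in> carrier Q" "y \<notin> A" "inv y \<in> carrier Q - A" using assms inv_outside_A by auto
  fix v assume v: "v \<in> common y"
  then have vS: "v \<in> S" "v \<otimes> inv y \<in> S" "v \<in> carrier Q" by (auto simp: common_def)
  have in_A: "v \<otimes> y \<notin> A" "v \<otimes> y \<in> common y" if "v \<in> A"
  proof -
    show "v \<otimes> y \<notin> A" using mult_outside(1)[OF that assms] by simp
    have "v \<otimes> y = y \<otimes> inv v" using inverts[OF assms, of "inv v"] that by simp
    then have "v \<otimes> y \<in> S" using vS S_inv_mult y by simp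
    then show "v \<otimes> y \<in> common y" using vS y by (simp add: common_def m_assoc)
  qed
  have out_A: "v \<otimes> inv y \<in> A" "v \<otimes> inv y \<in> common y" if "v \<notin> A"
  proof -
    show p: "v \<otimes> inv y \<in> A" using index_two vS y that by simp
    have "v \<otimes> inv y \<otimes> inv y = inv y \<otimes> inv (v \<otimes> inv y)"
      using inverts[OF y(3), of "inv (v \<otimes> inv y)"] p by simp
    also have "\<dots> = inv v" using vS y by (simp add: inv_mult_group m_assoc[symmetric])
    finally have "v \<otimes> inv y \<otimes> inv y = inv v" .
    then show "v \<otimes> inv y \<in> common y" using vS y S_inv by (simp add: common_def)
  qed
  show "(if v \<in> A then v \<otimes> y else v \<otimes> inv y) \<in> common y" using in_A out_A by auto
  show "(\<lambda>v. if v \<in> A then v \<otimes> y else v \<otimes> inv y) (if v \<in> A then v \<otimes> y else v \<otimes> inv y) = v"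
    using in_A out_A vS y by (auto simp: m_assoc)
  show "(if v \<in> A then v \<otimes> y else v \<otimes> inv y) \<noteq> v" using in_A out_A by auto
qed (rule finite_common)

text \<open>
  The involution reflects the part inside \<open>A\<close> by \<open>v \<mapsto> y v\<^sup>-\<^sup>1\<close>, whose fixed points are the square
  roots of \<open>y\<close>, and multiplies the part outside \<open>A\<close> by \<open>z\<close>.
\<close>

lemma even_common_involution:
  assumes "y \<in> A" "X \<subseteq> common y"
    and "\<And>v. v \<in> X \<Longrightarrow> v \<in> A \<Longrightarrow> y \<otimes> inv v \<in> X \<and> v \<otimes> v \<noteq> y"
    and "\<And>v. v \<in> X \<Longrightarrow> v \<notin> A \<Longrightarrow> z \<otimes> v \<in> X"
  shows "even (card X)"
proof (rule even_card_fixpoint_free_involution[where f = "\<lambda>v. if v \<in> A then y \<otimes> inv v else z \<otimes> v"])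
  show "finite X" using assms(2) finite_common finite_subset by blast
  fix v assume v: "v \<in> X"
  then have c: "v \<in> carrier Q" using assms(2) by (auto simp: common_def)
  have zv: "z \<otimes> v \<notin> A" if "v \<notin> A" using mult_outside(1)[OF z_in_A] c that by auto
  show "(if v \<in> A then y \<otimes> inv v else z \<otimes> v) \<in> X" using v assms by auto
  show "(\<lambda>v. if v \<in> A then y \<otimes> inv v else z \<otimes> v) (if v \<in> A then y \<otimes> inv v else z \<otimes> v) = v"
    using assms(1) c zv comm_A[of y v] by (auto simp: inv_mult_group m_assoc[symmetric] z_square) (simp add: m_assoc)
  show "(if v \<in> A then y \<otimes> inv v else z \<otimes> v) \<noteq> v"
  proof (cases "v \<in> A")
    case True
    then show ?thesis using assms(3)[OF v True] assms(1) c inv_solve_right[of v y v] by auto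
  next
    case False
    then show ?thesis using c z_neq_one r_cancel_one'[of v z] by auto
  qed
qed

text \<open>Since \<open>y\<close> is in \<open>A\<close>, both \<open>v\<close> and
  \<open>v \<otimes> inv y\<close> lie outside \<open>A\<close>, where multiplication by
  \<open>z\<close> is inversion and therefore preserves \<open>S\<close>.\<close>

lemma common_z_mult:
  assumes "y \<in> A" "v \<in> common y" "v \<notin> A" shows "z \<otimes> v \<in> common y"
proof -
  have v: "v \<in> S" "v \<otimes> inv y \<in> S" "v \<in> carrier Q" using assms(2) by (auto simp: common_def)
  moreover have "v \<otimes> inv y \<notin> A" using mult_outside(2)[of "inv y" v] assms v by auto
  ultimately show ?thesis using z_mult_S[of v] z_mult_S[of "v \<otimes> inv y"] assms
    by (simp add: common_def m_assoc)
qed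

text \<open>Up to inversion, the reflection exchanges the two conditions \<open>v \<in> S\<close>
  and \<open>v \<otimes> inv y \<in> S\<close>, because \<open>v\<close> and \<open>y\<close>
  commute.\<close>

lemma common_reflect:
  assumes "y \<in> A" "v \<in> common y" "v \<in> A" shows "y \<otimes> inv v \<in> common y"
proof -
  have v: "v \<in> S" "v \<otimes> inv y \<in> S" using assms(2) by (auto simp: common_def)
  have "y \<otimes> inv v \<otimes> inv y = inv v" using comm_A[of y "inv v"] assms by (simp add: m_assoc)
  then show ?thesis using v S_inv S_inv_mult[of y v] assms by (simp add: common_def)
qed

text \<open>The square roots of \<open>i \<otimes> i\<close> in \<open>A\<close> are
  \<open>i\<close> and \<open>z \<otimes> i\<close>. If the second is not in \<open>S\<close>, then
  \<open>i\<close> is the only fixed point of the involution on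
  \<open>common (i \<otimes> i)\<close>, whose cardinality is then odd.\<close>

lemma z_mult_S_inside:
  assumes i: "i \<in> S" "i \<in> A" and ev: "even (card (common (i \<otimes> i)))"
  shows "z \<otimes> i \<in> S"
proof (rule ccontr)
  assume nz: "z \<otimes> i \<notin> S"
  let ?y = "i \<otimes> i"
  have "even (card (common ?y - {i}))"
  proof (rule even_common_involution[of ?y])
    show "?y \<in> A" "common ?y - {i} \<subseteq> common ?y" using i by auto
  next
    fix v assume v: "v \<in> common ?y - {i}" "v \<in> A"
    have "v \<otimes> v \<noteq> ?y"
    proof
      assume "v \<otimes> v = ?y"
      then have "v = z \<otimes> i" using square_eq[of i v] v i by auto
      then show False using nz v by (auto simp: common_def)
    qed
    moreover have "?y \<otimes> inv v \<noteq> i"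
    proof
      assume "?y \<otimes> inv v = i"
      then have "?y = i \<otimes> v" using i v inv_solve_right'[of i ?y v] by auto
      then show False using i v by auto
    qed
    ultimately show "?y \<otimes> inv v \<in> common ?y - {i} \<and> v \<otimes> v \<noteq> ?y"
      using common_reflect[of ?y v] v i by auto
  next
    fix v assume v: "v \<in> common ?y - {i}" "v \<notin> A"
    have "z \<otimes> v \<noteq> i" using mult_outside(1)[OF z_in_A, of v] v i by (auto simp: common_def)
    then show "z \<otimes> v \<in> common ?y - {i}" using common_z_mult[of ?y v] v i by auto
  qed
  moreover have "i \<in> common ?y" using common_mult[of i i] i by simp
  ultimately show False using ev finite_common[of ?y] by (simp add: card_Diff_singleton card_gt_0_iff)
qed

end

section \<open>Vertices at distance 2 are twins\<close>

text \<open>The consequences of connectedness and transitivity in terms of the group.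
  \<open>reach\<close> is connectedness as an induction principle. \<open>dominating\<close>
  transfers from one edge at \<open>\<one>\<close> to any other the property that each vertex is
  adjacent to one of its ends.\<close>

locale two_distance_regular_quaternion_cayley = quaternion_cayley +
  assumes reach: "\<lbrakk>P \<one>; \<And>v s. \<lbrakk>v \<in> carrier Q; P v; s \<in> S\<rbrakk> \<Longrightarrow> P (s \<otimes> v); v \<in> carrier Q\<rbrakk> \<Longrightarrow> P v"
    and card_common_S: "\<lbrakk>s \<in> S; t \<in> S\<rbrakk> \<Longrightarrow> card (common s) = card (common t)"
    and card_common_two: "\<lbrakk>x \<in> at_two; y \<in> at_two\<rbrakk> \<Longrightarrow> card (common x) = card (common y)"
    and dominating: "\<lbrakk>s \<in> S; t \<in> S; \<And>v. v \<in> carrier Q \<Longrightarrow> v \<in> S \<or> v \<otimes> inv s \<in> S; v \<in> carrier Q\<rbrakk>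
      \<Longrightarrow> v \<in> S \<or> v \<otimes> inv t \<in> S"
    and A_proper: "A \<noteq> carrier Q"
begin

text \<open>If \<open>S\<close> were contained in \<open>A\<close>, no vertex outside
  \<open>A\<close> could be reached from \<open>\<one>\<close>.\<close>

lemma S_outside: obtains s where "s \<in> S" "s \<notin> A"
proof -
  have "\<exists>s\<in>S. s \<notin> A"
  proof (rule ccontr)
    assume none: "\<not> ?thesis"
    have "v \<in> A" if "v \<in> carrier Q" for v
    proof (rule reach[of "\<lambda>v. v \<in> A", OF _ _ that])
      fix v s assume "v \<in> A" "s \<in> S"
      then show "s \<otimes> v \<in> A" using none A.m_closed by blast
    qed simp
    then show False using A_proper A.subset by blast
  qed
  then show thesis using that by blast
qed

lemma mult_S_cases:
  assumes "s \<in> S" "t \<in> S" shows "s \<otimes> t = \<one> \<or> s \<otimes> t \<in> S \<or> s \<otimes> t \<in> at_two"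
  using common_mult[OF assms] assms by (auto simp: at_two_def)

text \<open>The conclusion says that \<open>y\<close> and \<open>\<one>\<close> are twins. The count
  is even at an element of \<open>S\<close> outside \<open>A\<close>, hence on all of
  \<open>S\<close>. So \<open>z_mult_S_inside\<close> applies to \<open>s\<close> whether
  \<open>s \<otimes> s\<close> lies in \<open>S\<close> or in \<open>at_two\<close>.\<close>

lemma common_at_two_if_even:
  assumes ev: "\<And>y. y \<in> at_two \<Longrightarrow> even (card (common y))" and y: "y \<in> at_two"
  shows "common y = S"
proof -
  obtain s0 where s0: "s0 \<in> S" "s0 \<notin> A" by (rule S_outside)
  have ev_S: "even (card (common s))" if "s \<in> S" for s
    using even_common_outside[of s0] card_common_S[OF that s0(1)] s0 by simp
  have z_mult: "z \<otimes> s \<in> S" if s: "s \<in> S" "s \<noteq> z" for s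
  proof (cases "s \<in> A")
    case True
    have "s \<otimes> s \<noteq> \<one>"
    proof
      assume "s \<otimes> s = \<one>"
      then have "\<one> \<otimes> \<one> = s \<otimes> s" by simp
      then have "s = \<one> \<or> s = z \<otimes> \<one>" by (rule square_eq[OF A.one_closed True])
      then show False using s by auto
    qed
    then have "even (card (common (s \<otimes> s)))" using ev ev_S mult_S_cases[OF s(1) s(1)] by blast
    then show ?thesis using z_mult_S_inside[OF s(1) True] by simp
  qed (use s z_mult_S in auto)
  show ?thesis
  proof (cases "z \<in> S")
    case False
    have "z \<otimes> s \<in> S" if "s \<in> S" for s using z_mult[OF that] False that by blast
    then have z: "common z = S" using z_central by (auto simp: common_def)
    \<comment> \<open>Here \<open>z\<close> attains the largest possible count
      \<open>card S\<close>, which is therefore the common value on \<open>at_two\<close>.\<close>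
    have "z \<in> at_two" unfolding at_two_def using z False z_neq_one s0 by auto
    then have "card (common y) = card S" using card_common_two[OF y] z by simp
    then show ?thesis using y by (intro common_full) (simp_all add: at_two_def)
  next
    case True
    have sub: "common s \<subseteq> S - {s}" if "s \<in> S" for s using that by (auto simp: common_def)
    have "common z = S - {z}" using z_mult z_central sub[OF True] by (auto simp: common_def z_square)
    then have "card (common s) = card (S - {s})" if "s \<in> S" for s
      using card_common_S[OF that True] that True finite_S by simp
    then have eq: "common s = S - {s}" if "s \<in> S" for s
      using sub that finite_S by (intro card_subset_eq) auto
    \<comment> \<open>Any two distinct elements of \<open>S\<close> are now adjacent, which leaves
      no vertex at distance 2: \<open>inv v\<close> and the inverse of
      \<open>v \<otimes> inv y\<close> are distinct elements of \<open>S\<close>, and their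
      adjacency puts \<open>y\<close> into \<open>S\<close>.\<close>
    obtain v where v: "v \<in> S" "v \<otimes> inv y \<in> S" using y by (auto simp: at_two_def common_def)
    have yc: "y \<in> carrier Q" "y \<noteq> \<one>" "y \<notin> S" using y by (auto simp: at_two_def)
    let ?s = "v \<otimes> inv y"
    have "inv ?s \<noteq> inv v"
    proof
      assume "inv ?s = inv v"
      then have "inv (inv ?s) = inv (inv v)" by simp
      then have "v \<otimes> inv y = v \<otimes> \<one>" using v by simp
      then have "inv y = \<one>" using v yc by (simp del: r_one)
      then show False using yc by (simp add: inv_eq_1_iff)
    qed
    then have "inv ?s \<in> common (inv v)" using eq v S_inv by blast
    then have "inv ?s \<otimes> v \<in> S" using v by (simp add: common_def)
    moreover have "inv ?s \<otimes> v = y" using v yc by (simp add: inv_mult_group m_assoc)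
    ultimately show ?thesis using yc by simp
  qed
qed

text \<open>Parity confines \<open>at_two\<close> to \<open>A\<close>, so a product of two elements
  of \<open>S\<close> that falls outside \<open>A\<close> is again in \<open>S\<close>. Propagated
  along walks, this puts every element outside \<open>A\<close> into \<open>S\<close>.\<close>

lemma common_at_two_if_odd:
  assumes odd: "\<And>y. y \<in> at_two \<Longrightarrow> odd (card (common y))" and y: "y \<in> at_two"
  shows "common y = S"
proof -
  have two_A: "x \<in> A" if "x \<in> at_two" for x
    using even_common_outside[of x] odd[OF that] that by (auto simp: at_two_def)
  obtain s0 where s0: "s0 \<in> S" "s0 \<notin> A" by (rule S_outside)
  let ?B = "S - A"
  have S_mult: "s \<otimes> t \<in> ?B" if "s \<in> S \<inter> A" "t \<in> ?B" for s t
  proof -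
    have "s \<otimes> t \<in> carrier Q - A" using mult_outside(1)[of s t] that by auto
    then show ?thesis using mult_S_cases[of s t] two_A[of "s \<otimes> t"] that by auto
  qed
  \<comment> \<open>If \<open>common x\<close> avoided \<open>A\<close>, multiplication by
    \<open>z\<close> would make its size even. A common neighbour \<open>v\<close> in
    \<open>A\<close> writes \<open>x\<close> as a product of two elements of
    \<open>S \<inter> A\<close>, and \<open>S_mult\<close> applies twice.\<close>
  have two_mult: "x \<otimes> t \<in> ?B" if x: "x \<in> at_two" and t: "t \<in> ?B" for x t
  proof -
    have xA: "x \<in> A" using two_A x .
    have "\<exists>v\<in>common x. v \<in> A"
    proof (rule ccontr)
      assume "\<not> ?thesis"
      then have "even (card (common x))"
        using common_z_mult[OF xA] by (intro even_common_involution[OF xA order.refl]) auto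
      then show False using odd x by simp
    qed
    then obtain v where v: "v \<in> S" "v \<in> A" "v \<otimes> inv x \<in> S" by (auto simp: common_def)
    have "x \<otimes> inv v \<in> S \<inter> A" using v xA S_inv_mult[of v x] by auto
    then have "(x \<otimes> inv v) \<otimes> (v \<otimes> t) \<in> ?B" using S_mult v t by blast
    moreover have "(x \<otimes> inv v) \<otimes> (v \<otimes> t) = x \<otimes> t"
      using v t xA by (simp add: m_assoc) (simp add: m_assoc[symmetric])
    ultimately show ?thesis by simp
  qed
  \<comment> \<open>\<open>K\<close> collects the elements of \<open>A\<close> whose left
    multiplication maps \<open>?B\<close> into itself; it is the invariant for the part of a walk
    that lies in \<open>A\<close>.\<close>
  define K where "K = {k \<in> A. \<forall>t\<in>?B. k \<otimes> t \<in> ?B}"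
  have K_inv: "inv (s \<otimes> t) \<in> K" and K_mult: "s \<otimes> t \<in> K" if st: "s \<in> ?B" "t \<in> ?B" for s t
  proof -
    have 1: "u \<otimes> w \<in> K" if "u \<in> ?B" "w \<in> ?B" for u w
      using mult_S_cases[of u w] index_two[of u w] S_mult two_mult that by (auto simp: K_def)
    show "s \<otimes> t \<in> K" using 1 st .
    have "inv s \<in> ?B" "inv t \<in> ?B" using st S_inv inv_outside_A[of s] inv_outside_A[of t] by auto
    then show "inv (s \<otimes> t) \<in> K" using 1 st by (simp add: inv_mult_group)
  qed
  have K_S: "s \<in> K" if "s \<in> S \<inter> A" for s using that S_mult by (auto simp: K_def)
  have K_closed: "k \<otimes> l \<in> K" if "k \<in> K" "l \<in> K" for k l
    using that by (auto simp: K_def m_assoc)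
  \<comment> \<open>The inverse of \<open>v\<close> is carried along because
    \<open>s \<otimes> v = inv v \<otimes> s\<close> for \<open>v\<close> in \<open>A\<close> and
    \<open>s\<close> outside \<open>A\<close>.\<close>
  have all: "v \<in> carrier Q \<Longrightarrow> (v \<in> A \<longrightarrow> v \<in> K \<and> inv v \<in> K) \<and> (v \<notin> A \<longrightarrow> v \<in> ?B)" for v
  proof (rule reach[of "\<lambda>v. (v \<in> A \<longrightarrow> v \<in> K \<and> inv v \<in> K) \<and> (v \<notin> A \<longrightarrow> v \<in> ?B)"])
    fix v s assume v: "v \<in> carrier Q" and IH: "(v \<in> A \<longrightarrow> v \<in> K \<and> inv v \<in> K) \<and> (v \<notin> A \<longrightarrow> v \<in> ?B)"
      and s: "s \<in> S"
    consider "v \<in> A" "s \<in> A" | "v \<in> A" "s \<notin> A" | "v \<notin> A" "s \<in> A" | "v \<notin> A" "s \<notin> A" by blast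
    then show "(s \<otimes> v \<in> A \<longrightarrow> s \<otimes> v \<in> K \<and> inv (s \<otimes> v) \<in> K) \<and> (s \<otimes> v \<notin> A \<longrightarrow> s \<otimes> v \<in> ?B)"
    proof cases
      case 1
      then have "s \<otimes> v \<in> K" "inv v \<otimes> inv s \<in> K" using IH s S_inv K_S K_closed by auto
      then show ?thesis using 1 v s by (auto simp: inv_mult_group)
    next
      case 2
      then have "s \<otimes> v = inv v \<otimes> s" using inverts s by simp
      moreover have "inv v \<otimes> s \<in> ?B" using 2 IH s by (auto simp: K_def)
      ultimately show ?thesis by auto
    next
      case 3
      then show ?thesis using S_mult[of s v] IH s by auto
    next
      case 4
      then show ?thesis using K_inv[of s v] K_mult[of s v] IH s by (auto simp: K_def)
    qed
  qed (auto simp: K_def)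
  \<comment> \<open>Vertices outside \<open>A\<close> are adjacent to \<open>\<one>\<close>,
    vertices of \<open>A\<close> to \<open>s0\<close>. After the transfer to an edge from
    \<open>\<one>\<close> to \<open>t\<close>, the vertex \<open>y\<close>, being outside
    \<open>S\<close>, must be adjacent to \<open>t\<close>.\<close>
  have "v \<in> S \<or> v \<otimes> inv s0 \<in> S" if v: "v \<in> carrier Q" for v
  proof (cases "v \<in> A")
    case True
    then have "v \<otimes> inv s0 \<in> carrier Q - A" using mult_outside(1)[OF True inv_outside_A] s0 by auto
    then show ?thesis using all by auto
  qed (use all v in auto)
  then have dom: "v \<in> S \<or> v \<otimes> inv t \<in> S" if "v \<in> carrier Q" "t \<in> S" for v t
    using dominating[OF s0(1) that(2) _ that(1)] by blast
  have "t \<otimes> inv y \<in> S" if "t \<in> S" for t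
    using dom[of y t] that y S_inv_mult[of y t] by (auto simp: at_two_def)
  then show ?thesis by (auto simp: common_def)
qed

text \<open>The count is constant on \<open>at_two\<close>, so its parity at \<open>y\<close>
  decides the case for all vertices there.\<close>

lemma common_at_two:
  assumes y: "y \<in> at_two" shows "common y = S"
proof (cases "even (card (common y))")
  case True
  then have "even (card (common x))" if "x \<in> at_two" for x using card_common_two[OF y that] by simp
  then show ?thesis using common_at_two_if_even y by blast
next
  case False
  then have "odd (card (common x))" if "x \<in> at_two" for x using card_common_two[OF y that] by simp
  then show ?thesis using common_at_two_if_odd y by blast
qed

text \<open>\<open>W\<close>, the set of twins of \<open>\<one>\<close>, is the stabilizer of
  \<open>S\<close> under right multiplication and hence a subgroup. Vertices at distance 2 belong to
  it, so no walk from \<open>\<one>\<close> leaves the union of \<open>S\<close> and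
  \<open>W\<close>.\<close>

lemma S_complement_subgroup:
  obtains W where "subgroup W Q" "S = carrier Q - W"
proof -
  define W where "W = {w \<in> carrier Q. common w = S}"
  have W_iff: "w \<in> W \<longleftrightarrow> w \<in> carrier Q \<and> (\<forall>s\<in>S. s \<otimes> inv w \<in> S)" for w
    by (auto simp: W_def common_def)
  have sub: "subgroup W Q"
  proof
    show "W \<subseteq> carrier Q" "\<one> \<in> W" by (auto simp: W_iff)
  next
    fix x y assume "x \<in> W" "y \<in> W"
    then show "x \<otimes> y \<in> W" by (auto simp: W_iff inv_mult_group m_assoc[symmetric])
  next
    fix x assume x: "x \<in> W"
    \<comment> \<open>Finiteness of \<open>S\<close> makes the injective map into \<open>S\<close>
      surjective, which is what closure under inverses requires.\<close>
    have image: "(\<lambda>s. s \<otimes> inv x) ` S = S"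
    proof (rule card_subset_eq[OF finite_S])
      show "card ((\<lambda>s. s \<otimes> inv x) ` S) = card S"
        using x by (intro card_image inj_onI) (auto simp: W_iff)
    qed (use x in \<open>auto simp: W_iff\<close>)
    have "s \<otimes> x \<in> S" if s: "s \<in> S" for s
    proof -
      obtain t where "t \<in> S" "s = t \<otimes> inv x" using s image by blast
      then show ?thesis using x by (simp add: W_iff m_assoc)
    qed
    then show "inv x \<in> W" using x by (auto simp: W_iff)
  qed
  have "v \<in> S \<or> v \<in> W" if "v \<in> carrier Q" for v
  proof (rule reach[of "\<lambda>v. v \<in> S \<or> v \<in> W", OF _ _ that])
    show "\<one> \<in> S \<or> \<one> \<in> W" using subgroup.one_closed[OF sub] by simp
  next
    fix v s assume v: "v \<in> carrier Q" "v \<in> S \<or> v \<in> W" and s: "s \<in> S"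
    show "s \<otimes> v \<in> S \<or> s \<otimes> v \<in> W"
    proof (cases "v \<in> S")
      case True
      consider "s \<otimes> v = \<one>" | "s \<otimes> v \<in> S" | "s \<otimes> v \<in> at_two" using mult_S_cases[OF s True] by blast
      then show ?thesis
      proof cases
        case 1 then show ?thesis using subgroup.one_closed[OF sub] by simp
      next
        case 2 then show ?thesis ..
      next
        case 3 then have "s \<otimes> v \<in> W" using common_at_two[OF 3] s v(1) by (simp add: W_def)
        then show ?thesis ..
      qed
    next
      case False
      then have "inv v \<in> W" using v subgroup.m_inv_closed[OF sub] by blast
      then show ?thesis using s v by (auto simp: W_iff)
    qed
  qed
  moreover have "s \<notin> W" if "s \<in> S" for s
  proof
    assume "s \<in> W"
    then have "s \<otimes> inv s \<in> S" using that unfolding W_iff by blast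
    then show False using that by simp
  qed
  ultimately have "S = carrier Q - W" by auto
  with sub show thesis using that by blast
qed

end

section \<open>Recognising complete multipartite graphs\<close>

text \<open>Arcs are pairs of vertices here, so the vertex bijection \<open>f\<close> determines the
  arc map \<open>map_prod f f\<close>.\<close>

lemma digraph_iso_with_projI:
  assumes "pair_wf_digraph G" "bij_betw f (pverts G) (pverts H)"
    and "\<And>u v. \<lbrakk>u \<in> pverts G; v \<in> pverts G\<rbrakk> \<Longrightarrow> (f u, f v) \<in> parcs H \<longleftrightarrow> (u, v) \<in> parcs G"
    and "parcs H \<subseteq> pverts H \<times> pverts H"
  shows "digraph_iso (with_proj G) (with_proj H)"
proof -
  interpret pair_wf_digraph G by fact
  let ?h = "\<lparr>iso_verts = f, iso_arcs = map_prod f f, iso_head = snd, iso_tail = fst\<rparr>"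
  have inj: "inj_on f (pverts G)" and img: "f ` pverts G = pverts H"
    using assms(2) by (auto simp: bij_betw_def)
  have sub: "parcs G \<subseteq> pverts G \<times> pverts G" using wellformed' by auto
  have "inj_on (map_prod f f) (parcs G)"
    using inj_on_subset[OF map_prod_inj_on[OF inj inj] sub] .
  then have "pre_digraph.digraph_isomorphism (with_proj G) ?h"
    using inj wf_digraph by (simp add: pre_digraph.digraph_isomorphism_def)
  moreover have "map_prod f f ` parcs G = parcs H"
  proof
    show "map_prod f f ` parcs G \<subseteq> parcs H" using sub assms(3) by auto
    show "parcs H \<subseteq> map_prod f f ` parcs G"
    proof
      fix e assume e: "e \<in> parcs H"
      then obtain u v where "u \<in> pverts G" "v \<in> pverts G" "e = (f u, f v)"
        using assms(4) img by blast
      then show "e \<in> map_prod f f ` parcs G" using e assms(3) by (auto intro!: image_eqI[of _ _ "(u, v)"])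
    qed
  qed
  ultimately show ?thesis
    unfolding digraph_iso_def by (intro exI[of _ ?h] conjI) (auto simp: app_iso_def img with_proj_def)
qed

text \<open>A vertex is sent to the number of its part and its position within that part; equal part
  sizes let all positions range over \<open>{..<y}\<close>.\<close>

lemma complete_multipartite_iso:
  assumes G: "pair_wf_digraph G" and fin: "finite (pverts G)" and disj: "disjoint P" and cover: "\<Union>P = pverts G"
    and card_part: "\<And>p. p \<in> P \<Longrightarrow> card p = y"
    and arcs: "\<And>u v p. \<lbrakk>p \<in> P; u \<in> p; v \<in> pverts G\<rbrakk> \<Longrightarrow> (u, v) \<in> parcs G \<longleftrightarrow> v \<notin> p"
  shows "digraph_iso (with_proj G) (with_proj (complete_multipartite (card P) y))"
proof -
  have finP: "finite P" using fin cover by (simp add: finite_UnionD)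
  obtain \<iota> where \<iota>: "bij_betw \<iota> P {..<card P}"
    using ex_bij_betw_finite_nat[OF finP] atLeast0LessThan by metis
  have "\<exists>h. bij_betw h p {..<y}" if "p \<in> P" for p
  proof -
    have "p \<subseteq> pverts G" using that cover by blast
    then have "finite p" using fin by (rule finite_subset)
    then show ?thesis using ex_bij_betw_finite_nat[of p] card_part[OF that] atLeast0LessThan by metis
  qed
  then obtain h where h: "\<And>p. p \<in> P \<Longrightarrow> bij_betw (h p) p {..<y}" by metis
  have "\<exists>p\<in>P. v \<in> p" if "v \<in> pverts G" for v using that cover by blast
  then obtain part where part: "\<And>v. v \<in> pverts G \<Longrightarrow> part v \<in> P \<and> v \<in> part v" by metis
  have part_eq: "part v = p" if "p \<in> P" "v \<in> p" for p v
  proof -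
    have "v \<in> pverts G" using that cover by blast
    then show ?thesis using disjointD[OF disj, of "part v" p] part that by blast
  qed
  let ?f = "\<lambda>v. (\<iota> (part v), h (part v) v)"
  have \<iota>_eq: "\<iota> p = \<iota> q \<longleftrightarrow> p = q" if "p \<in> P" "q \<in> P" for p q
    using \<iota> that by (auto simp: bij_betw_def inj_on_def)
  show ?thesis
  proof (rule digraph_iso_with_projI[OF G, of ?f])
    show bij: "bij_betw ?f (pverts G) (pverts (complete_multipartite (card P) y))"
      unfolding bij_betw_def
    proof
      show "inj_on ?f (pverts G)"
      proof (rule inj_onI)
        fix u v assume uv: "u \<in> pverts G" "v \<in> pverts G" "?f u = ?f v"
        then have "part u = part v" using \<iota>_eq part by auto
        then show "u = v" using uv h[of "part v"] part[of u] part[of v] by (auto simp: bij_betw_def inj_on_def)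
      qed
      show "?f ` pverts G = pverts (complete_multipartite (card P) y)"
      proof
        show "?f ` pverts G \<subseteq> pverts (complete_multipartite (card P) y)"
          using part h \<iota> by (auto simp: complete_multipartite_def bij_betw_def)
        show "pverts (complete_multipartite (card P) y) \<subseteq> ?f ` pverts G"
        proof
          fix e assume "e \<in> pverts (complete_multipartite (card P) y)"
          then obtain i j where e: "e = (i, j)" "i < card P" "j < y" by (auto simp: complete_multipartite_def)
          then obtain p where p: "p \<in> P" "\<iota> p = i" using bij_betw_imp_surj_on[OF \<iota>] by (metis imageE lessThan_iff)
          then obtain v where v: "v \<in> p" "h p v = j" using bij_betw_imp_surj_on[OF h[OF p(1)]] e by (metis imageE lessThan_iff)
          then have "?f v = e" using p e part_eq[OF p(1) v(1)] by simp
          moreover have "v \<in> pverts G" using v p cover by blast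
          ultimately show "e \<in> ?f ` pverts G" by blast
        qed
      qed
    qed
    fix u v assume uv: "u \<in> pverts G" "v \<in> pverts G"
    have "(?f u, ?f v) \<in> parcs (complete_multipartite (card P) y) \<longleftrightarrow> \<iota> (part u) \<noteq> \<iota> (part v)"
      using uv bij unfolding bij_betw_def by (auto simp: complete_multipartite_def)
    also have "\<dots> \<longleftrightarrow> v \<notin> part u" using \<iota>_eq part uv part_eq by metis
    also have "\<dots> \<longleftrightarrow> (u, v) \<in> parcs G" using arcs[of "part u" u v] part uv by blast
    finally show "(?f u, ?f v) \<in> parcs (complete_multipartite (card P) y) \<longleftrightarrow> (u, v) \<in> parcs G" .
  qed (auto simp: complete_multipartite_def)
qed


section \<open>From distances and automorphisms to the group\<close>

lemma (in wf_digraph) awalk_cost_one: "awalk_cost (\<lambda>_. 1) p = real (length p)"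
  by (induction p) auto

text \<open>\<open>gdist\<close> is an infimum over walks: the arc itself gives the upper bound, and
  \<open>u \<noteq> v\<close> excludes the empty walk.\<close>

lemma gdist_one:
  assumes "pair_wf_digraph G" "(u, v) \<in> parcs G" "u \<noteq> v"
  shows "gdist G u v = 1"
proof -
  interpret pair_wf_digraph G by fact
  have "awalk u [(u, v)] v" using assms(2) wellformed' by (auto simp: awalk_def)
  then have "gdist G u v \<le> 1"
    unfolding gdist_def using min_cost_le_walk_cost[of u "[(u, v)]" v "\<lambda>_. 1"] by (simp add: one_ereal_def)
  moreover have "1 \<le> awalk_cost (\<lambda>_. 1) p" if "awalk u p v" for p
    using that assms(3) by (cases p) (auto simp: awalk_cost_one)
  then have "1 \<le> gdist G u v"
    unfolding gdist_def \<mu>_def by (intro INF_greatest) simp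
  ultimately show ?thesis by simp
qed

text \<open>The walk through \<open>w\<close> gives the upper bound; walks with fewer than two arcs
  are excluded by the last two hypotheses.\<close>

lemma gdist_two:
  assumes "pair_wf_digraph G" "(u, w) \<in> parcs G" "(w, v) \<in> parcs G" "(u, v) \<notin> parcs G" "u \<noteq> v"
  shows "gdist G u v = 2"
proof -
  interpret pair_wf_digraph G by fact
  have "awalk u [(u, w), (w, v)] v" using assms(2,3) wellformed' by (auto simp: awalk_def)
  then have "gdist G u v \<le> 2"
    unfolding gdist_def using min_cost_le_walk_cost[of u "[(u, w), (w, v)]" v "\<lambda>_. 1"]
    by (simp add: one_ereal_def)
  moreover have "2 \<le> awalk_cost (\<lambda>_. 1) p" if p: "awalk u p v" for p
  proof -
    have "p \<noteq> []" "\<And>e. p \<noteq> [e]" using p assms(4,5) by (auto simp: awalk_def cas.simps)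
    then obtain e f q where "p = e # f # q" by (metis list.exhaust)
    then show ?thesis by (simp add: awalk_cost_one)
  qed
  then have "2 \<le> gdist G u v"
    unfolding gdist_def \<mu>_def by (intro INF_greatest) simp
  ultimately show ?thesis by simp
qed

lemma graph_automorphism_card_common:
  assumes "graph_automorphism G f" "u \<in> pverts G" "v \<in> pverts G"
  shows "card {w \<in> pverts G. (u, w) \<in> parcs G \<and> (v, w) \<in> parcs G} =
    card {w \<in> pverts G. (f u, w) \<in> parcs G \<and> (f v, w) \<in> parcs G}"
proof (rule bij_betw_same_card[of f])
  have bij: "bij_betw f (pverts G) (pverts G)"
    and arc: "\<And>u v. \<lbrakk>u \<in> pverts G; v \<in> pverts G\<rbrakk> \<Longrightarrow> (f u, f v) \<in> parcs G \<longleftrightarrow> (u, v) \<in> parcs G"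
    using assms(1) by (auto simp: graph_automorphism_def)
  let ?N = "{w \<in> pverts G. (u, w) \<in> parcs G \<and> (v, w) \<in> parcs G}"
  let ?N' = "{w \<in> pverts G. (f u, w) \<in> parcs G \<and> (f v, w) \<in> parcs G}"
  have "f ` ?N = ?N'"
  proof
    show "f ` ?N \<subseteq> ?N'" using arc assms(2,3) bij_betwE[OF bij] by auto
    show "?N' \<subseteq> f ` ?N"
    proof
      fix w assume w: "w \<in> ?N'"
      then obtain x where "x \<in> pverts G" "w = f x" using bij_betw_imp_surj_on[OF bij] by blast
      then show "w \<in> f ` ?N" using w arc assms(2,3) by auto
    qed
  qed
  moreover have "inj_on f ?N" using bij_betw_imp_inj_on[OF bij] by (rule inj_on_subset) auto
  ultimately show "bij_betw f ?N ?N'" by (simp add: bij_betw_def)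
qed

lemma cayley_graph_arc:
  assumes "group Q" "S \<subseteq> carrier Q"
  shows "(u, v) \<in> parcs (cayley_graph Q S) \<longleftrightarrow> u \<in> carrier Q \<and> v \<in> carrier Q \<and> v \<otimes>\<^bsub>Q\<^esub> inv\<^bsub>Q\<^esub> u \<in> S"
proof
  interpret group Q by fact
  {
    assume "(u, v) \<in> parcs (cayley_graph Q S)"
    then obtain s where "s \<in> S" "u \<in> carrier Q" "v = s \<otimes>\<^bsub>Q\<^esub> u" by (auto simp: cayley_graph_def)
    then show "u \<in> carrier Q \<and> v \<in> carrier Q \<and> v \<otimes>\<^bsub>Q\<^esub> inv\<^bsub>Q\<^esub> u \<in> S"
      using assms(2) by (auto simp: m_assoc subset_iff)
  next
    assume a: "u \<in> carrier Q \<and> v \<in> carrier Q \<and> v \<otimes>\<^bsub>Q\<^esub> inv\<^bsub>Q\<^esub> u \<in> S"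
    then have "v = (v \<otimes>\<^bsub>Q\<^esub> inv\<^bsub>Q\<^esub> u) \<otimes>\<^bsub>Q\<^esub> u" by (simp add: m_assoc)
    with a show "(u, v) \<in> parcs (cayley_graph Q S)" unfolding cayley_graph_def by auto
  }
qed

text \<open>Transitivity is applied to pairs starting at \<open>\<one>\<close>: an automorphism that
  fixes \<open>\<one>\<close> and takes \<open>x\<close> to \<open>y\<close> also preserves the
  number of common neighbours with \<open>\<one>\<close>. This supplies the regularity
  conditions.\<close>

lemma (in quaternion_cayley) two_distance_transitive_S_complement_subgroup:
  assumes conn: "connected (with_proj (cayley_graph Q S))"
    and trans: "two_distance_transitive (cayley_graph Q S)"
    and A_proper: "A \<noteq> carrier Q"
  obtains W where "subgroup W Q" "S = carrier Q - W" "S \<noteq> {}"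
proof -
  let ?G = "cayley_graph Q S"
  have verts: "pverts ?G = carrier Q" by (simp add: cayley_graph_def)
  have arc: "(u, v) \<in> parcs ?G \<longleftrightarrow> u \<in> carrier Q \<and> v \<in> carrier Q \<and> v \<otimes> inv u \<in> S" for u v
    using S_subset by (intro cayley_graph_arc is_group) auto
  have "S = m_inv Q ` S" using S_inv by (force intro: image_eqI[of _ "m_inv Q" "inv _"])
  then interpret G: pair_graph ?G by (intro pair_graph_cayley is_group finite_carrier S_subset)
  have wf: "pair_wf_digraph ?G" ..
  have move: "\<exists>f. graph_automorphism ?G f \<and> f \<one> = \<one> \<and> f x = y"
    if "x \<in> carrier Q" "y \<in> carrier Q" "gdist ?G \<one> x = i" "gdist ?G \<one> y = i" "i \<in> {1, 2}" for x y i
    using trans that unfolding two_distance_transitive_def verts by (metis one_closed)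
  have common: "common x = {w \<in> pverts ?G. (\<one>, w) \<in> parcs ?G \<and> (x, w) \<in> parcs ?G}" if "x \<in> carrier Q" for x
    using that by (auto simp: common_def arc verts)
  have card_eq: "card (common x) = card (common y)"
    if xy: "x \<in> carrier Q" "y \<in> carrier Q" "gdist ?G \<one> x = i" "gdist ?G \<one> y = i" "i \<in> {1, 2}" for x y i
  proof -
    obtain f where "graph_automorphism ?G f" "f \<one> = \<one>" "f x = y" using move[OF xy] by blast
    then show ?thesis
      using graph_automorphism_card_common[of ?G f \<one> x] common xy(1,2) by (simp add: verts)
  qed
  have dist_S: "gdist ?G \<one> s = 1" if "s \<in> S" for s
    using that by (intro gdist_one wf) (auto simp: arc)
  have dist_two: "gdist ?G \<one> y = 2" if y: "y \<in> at_two" for y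
  proof -
    obtain v where "v \<in> S" "v \<otimes> inv y \<in> S" using y by (auto simp: at_two_def common_def)
    moreover from this have "y \<otimes> inv v \<in> S" using y S_inv_mult[of v y] by (simp add: at_two_def)
    ultimately show ?thesis using y by (intro gdist_two[of _ _ v] wf) (auto simp: arc at_two_def)
  qed
  interpret two_distance_regular_quaternion_cayley Q A z S
  proof
    fix P v assume base: "P \<one>" and step: "\<And>v s. \<lbrakk>v \<in> carrier Q; P v; s \<in> S\<rbrakk> \<Longrightarrow> P (s \<otimes> v)"
      and v: "v \<in> carrier Q"
    \<comment> \<open>\<open>connected\<close> concerns the underlying undirected graph. Symmetry of
      the arcs turns it into directed reachability, where each arc is a left multiplication by an
      element of \<open>S\<close>.\<close>
    have "strongly_connected (with_proj ?G)"
      using G.symmetric_connected_imp_strongly_connected conn G.sym_arcs by blast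
    then have "\<one> \<rightarrow>\<^sup>*\<^bsub>with_proj ?G\<^esub> v" using v by (auto simp: strongly_connected_def verts)
    then show "P v"
    proof (induction rule: G.reachable_induct)
      case base then show ?case using \<open>P \<one>\<close> by simp
    next
      case (step x y)
      then have "(x, y) \<in> parcs ?G" by simp
      then have xy: "x \<in> carrier Q" "y \<in> carrier Q" "y \<otimes> inv x \<in> S" by (auto simp: arc)
      then have "P ((y \<otimes> inv x) \<otimes> x)" using step.IH \<open>\<And>v s. \<lbrakk>v \<in> carrier Q; P v; s \<in> S\<rbrakk> \<Longrightarrow> P (s \<otimes> v)\<close> by blast
      then show ?case using xy by (simp add: m_assoc)
    qed
  next
    fix s t assume "s \<in> S" "t \<in> S"
    then show "card (common s) = card (common t)" by (intro card_eq[of s t 1]) (auto simp: dist_S)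
  next
    fix x y assume "x \<in> at_two" "y \<in> at_two"
    then show "card (common x) = card (common y)"
      by (intro card_eq[of x y 2]) (auto simp: dist_two, auto simp: at_two_def)
  next
    fix s t v assume s: "s \<in> S" and t: "t \<in> S" and v: "v \<in> carrier Q"
      and dom: "\<And>v. v \<in> carrier Q \<Longrightarrow> v \<in> S \<or> v \<otimes> inv s \<in> S"
    have sc: "s \<in> carrier Q" and tc: "t \<in> carrier Q" using s t by simp_all
    \<comment> \<open>The domination property is used at the preimage of \<open>v\<close> and
      carried forward by \<open>f\<close>, which takes the edge from \<open>\<one>\<close> to
      \<open>s\<close> to the edge from \<open>\<one>\<close> to \<open>t\<close>.\<close>
    obtain f where f: "graph_automorphism ?G f" "f \<one> = \<one>" "f s = t"
      using move[OF sc tc dist_S[OF s] dist_S[OF t]] by blast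
    then have "f ` carrier Q = carrier Q" by (auto simp: graph_automorphism_def bij_betw_def verts)
    then obtain x where x: "x \<in> carrier Q" "f x = v" using v by (metis imageE)
    have arcs: "(f p, f q) \<in> parcs ?G \<longleftrightarrow> (p, q) \<in> parcs ?G" if "p \<in> carrier Q" "q \<in> carrier Q" for p q
      using f(1) that by (auto simp: graph_automorphism_def verts)
    have "(\<one>, x) \<in> parcs ?G \<or> (s, x) \<in> parcs ?G" using dom[OF x(1)] x s by (auto simp: arc)
    then have "(\<one>, v) \<in> parcs ?G \<or> (t, v) \<in> parcs ?G"
      using arcs[OF one_closed x(1)] arcs[OF sc x(1)] f x by auto
    then show "v \<in> S \<or> v \<otimes> inv t \<in> S" by (auto simp: arc)
  qed (fact A_proper)
  obtain s where "s \<in> S" using S_outside by blast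
  then show thesis using S_complement_subgroup that by blast
qed

section \<open>Cosets as the parts of a multipartite graph\<close>

theorem theorem1p2:
  fixes n :: nat
    and Q :: "('a, 'c) monoid_scheme"
    and S :: "'a set"
    and \<Gamma> :: "'a pair_pre_digraph"
  assumes "n \<ge> 2"
    and "generalized_quaternion n Q"
    and "S \<subseteq> carrier Q - {\<one>\<^bsub>Q\<^esub>}"
    and "S = m_inv Q ` S"
    and "\<Gamma> = cayley_graph Q S"
    and "connected (with_proj \<Gamma>)"
    and "two_distance_transitive \<Gamma>"
  shows
    "(\<exists>x y. x \<ge> 3 \<and> y \<ge> 2 \<and> x * y = 4 * n \<and>
        digraph_iso (with_proj \<Gamma>) (with_proj (complete_multipartite x y)))
     \<or> complete_bipartite_digraph (2 * n) (2 * n) (with_proj \<Gamma>)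
     \<or> (n \<ge> 3 \<and> digraph_iso (with_proj \<Gamma>) (with_proj (bip_minus_matching {..<2 * n})))
     \<or> (\<exists>d q (F :: nat ring). d \<ge> 2 \<and> primepow q \<and> is_GF q F \<and>
          2 * n = (q ^ d - 1) div (q - 1) \<and>
          (digraph_iso (with_proj \<Gamma>) (with_proj (B_PG F d)) \<or>
           digraph_iso (with_proj \<Gamma>) (with_proj (B'_PG F d))))
     \<or> (\<exists>d q (F :: nat ring) \<theta>. odd q \<and> primepow q \<and> is_GF q F \<and>
          d \<ge> 2 \<and> d dvd q - 1 \<and> 2 * n = d * (q + 1) \<and>
          \<theta> \<in> carrier (mult_of F) \<and> generate (mult_of F) {\<theta>} = carrier (mult_of F) \<and>
          digraph_iso (with_proj \<Gamma>) (with_proj (K2d F \<theta> d)))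
     \<or> (\<exists>q (F :: nat ring). primepow q \<and> is_GF q F \<and> q mod 4 = 3 \<and> q = n - 1 \<and>
          digraph_iso (with_proj \<Gamma>) (with_proj (X1 F)))
     \<or> (\<exists>d q r (F :: nat ring) N. d \<ge> 2 \<and> primepow q \<and> is_GF q F \<and>
          r > 0 \<and> r dvd q - 1 \<and> scalar_subgroup F r N \<and>
          digraph_iso (with_proj \<Gamma>) (with_proj (Gamma_dqN F d N)))
     \<or> digraph_iso (with_proj \<Gamma>) (with_proj X_2_2)
     \<or> digraph_iso (with_proj \<Gamma>) (with_proj X'_3_2)
     \<or> digraph_iso (with_proj \<Gamma>) (with_proj X2_3)"
proof -
  obtain A z where "quaternion_group Q A z" and card_A: "card A = 2 * n"
    using generalized_quaternion_cyclic_subgroup[OF assms(1,2)] .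
  then interpret quaternion_group Q A z by simp
  have ord: "order Q = 4 * n" using assms(2) by (simp add: generalized_quaternion_def)
  interpret quaternion_cayley Q A z S
  proof
    fix s assume "s \<in> S" then show "inv\<^bsub>Q\<^esub> s \<in> S" using assms(4) by blast
  qed (fact assms(3))
  have "A \<noteq> carrier Q" using card_A ord assms(1) by (auto simp: order_def)
  then obtain W where W: "subgroup W Q" and S_W: "S = carrier Q - W" and "S \<noteq> {}"
    using two_distance_transitive_S_complement_subgroup assms(5-7) by blast
  interpret G: pair_graph \<Gamma>
    unfolding assms(5) by (intro pair_graph_cayley is_group finite_carrier assms(3,4))
  have verts: "pverts \<Gamma> = carrier Q" by (simp add: assms(5) cayley_graph_def)
  have arc: "(u, v) \<in> parcs \<Gamma> \<longleftrightarrow> u \<in> carrier Q \<and> v \<in> carrier Q \<and> v \<otimes>\<^bsub>Q\<^esub> inv\<^bsub>Q\<^esub> u \<in> S" for u v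
    unfolding assms(5) using S_subset by (intro cayley_graph_arc is_group) auto
  \<comment> \<open>Two vertices are non-adjacent or equal exactly if they lie in the same right
    coset of \<open>W\<close>, so the cosets are the parts, and Lagrange's theorem gives the product
    of their number and size.\<close>
  let ?P = "rcosets\<^bsub>Q\<^esub> W"
  have prod: "card ?P * card W = 4 * n" using lagrange[OF W] ord by (simp add: mult.commute)
  have cover: "\<Union>?P = carrier Q" using rcosets_part_G[OF W] .
  have disj: "disjoint ?P" using rcos_disjoint[OF W] .
  have card_part: "card p = card W" if "p \<in> ?P" for p
    using card_rcosets_equal[OF that subgroup.subset[OF W]] by simp
  have arc_part: "(u, v) \<in> parcs \<Gamma> \<longleftrightarrow> v \<notin> p" if p: "p \<in> ?P" and u_p: "u \<in> p" and v: "v \<in> carrier Q" for u v p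
  proof -
    have u: "u \<in> carrier Q" using p u_p cover by blast
    obtain x where x: "x \<in> carrier Q" "p = W #>\<^bsub>Q\<^esub> x" using p by (auto simp: RCOSETS_def)
    have "p = W #>\<^bsub>Q\<^esub> u" using repr_independence[of u W x] u_p x W by simp
    then have "v \<in> p \<longleftrightarrow> v \<otimes>\<^bsub>Q\<^esub> inv\<^bsub>Q\<^esub> u \<in> W"
      using subgroup.rcos_module[OF W is_group u v] by simp
    then show ?thesis using u v by (auto simp: arc S_W)
  qed
  have finW: "finite W" using finite_subset[OF subgroup.subset[OF W] finite_carrier] .
  have "card W \<noteq> 0" using prod assms(1) by (intro notI) simp
  \<comment> \<open>A trivial \<open>W\<close> would make the graph complete, which the definition
    of 2-distance-transitivity excludes.\<close>
  moreover have "card W \<noteq> 1"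
  proof
    assume "card W = 1"
    then have "W = {\<one>\<^bsub>Q\<^esub>}" using subgroup.one_closed[OF W] by (metis card_1_singletonE singletonD)
    then have "(u, v) \<in> parcs \<Gamma> \<longleftrightarrow> u \<in> carrier Q \<and> v \<in> carrier Q \<and> u \<noteq> v" for u v
      by (auto simp: arc S_W) (metis inv_equality inv_inv inv_closed)
    then have "complete_digraph (card (pverts \<Gamma>)) (with_proj \<Gamma>)"
      by (auto simp: complete_digraph_pair_def verts finite_carrier)
    then show False using assms(7) by (simp add: two_distance_transitive_def)
  qed
  ultimately have y: "card W \<ge> 2" by linarith
  have "card ?P \<noteq> 0" using prod assms(1) by (intro notI) simp
  moreover have "card ?P \<noteq> 1"
  proof
    assume "card ?P = 1"
    then have "card W = card (carrier Q)" using prod ord by (simp add: order_def)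
    then have "W = carrier Q" using subgroup.subset[OF W] finite_carrier by (intro card_subset_eq)
    then show False using \<open>S \<noteq> {}\<close> S_W by simp
  qed
  \<comment> \<open>Two parts give the complete bipartite graph; the multipartite family starts at
    three parts.\<close>
  ultimately consider "card ?P = 2" | "card ?P \<ge> 3" by linarith
  then show ?thesis
  proof cases
    case 1
    then obtain U V where UV: "?P = {U, V}" "U \<noteq> V" by (auto simp: card_2_iff)
    have "card U = 2 * n" "card V = 2 * n" using prod 1 card_part UV by auto
    moreover have UV_carrier: "carrier Q = U \<union> V" "U \<inter> V = {}"
      using cover disj UV by (auto simp: pairwise_def disjnt_def)
    moreover have "parcs \<Gamma> = U \<times> V \<union> V \<times> U"
    proof -
      have "(u, v) \<in> parcs \<Gamma> \<longleftrightarrow> (u, v) \<in> U \<times> V \<union> V \<times> U" if "u \<in> carrier Q" "v \<in> carrier Q" for u v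
        using arc_part[of U u v] arc_part[of V u v] that UV UV_carrier by auto
      moreover have "parcs \<Gamma> \<subseteq> carrier Q \<times> carrier Q" by (auto simp: arc)
      ultimately show ?thesis using UV_carrier by auto
    qed
    ultimately have "complete_bipartite_digraph (2 * n) (2 * n) (with_proj \<Gamma>)"
      using finite_carrier by (auto simp: complete_bipartite_digraph_pair_def verts)
    then show ?thesis by (intro disjI2 disjI1)
  next
    case 2
    have "digraph_iso (with_proj \<Gamma>) (with_proj (complete_multipartite (card ?P) (card W)))"
      using arc_part card_part cover disj finite_carrier
      by (intro complete_multipartite_iso) (auto simp: verts intro: G.pair_wf_digraph_axioms)
    then show ?thesis using 2 y prod by (intro disjI1 exI conjI)
  qed
qed

end
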